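(* For the Bounded Cost Minimum Diameter Edge Addition problem restricted to unit costs (with budget $B=k$), there exists a $((k+1)^2,3)$-approximation algorithm with running time $O(kn^3)$, where $n$ is the number of vertices of the input graph.
   Context: Bounded Cost Minimum Diameter Edge Addition: input is an undirected graph $G=(V,E)$, a weight function $w:[V]^2\to\mathbb{N}$, a cost function $c:[V]^2\to\mathbb{N}^*$ (where $[V]^2$ is the set of unordered vertex pairs) and an integer $B$; the goal is a set $F$ of non-edges of $G$ with $\sum_{e\in F}c(e)\le B$ minimizing the diameter (largest shortest-path distance, path weight = sum of edge weights under $w$) of $(V,E\cup F)$; $D^B_{opt}$ denotes this minimum. In the unit-cost restriction $c\equiv1$, so one may add at most $k=B$ non-edges. An $(\alpha,\beta)$-approximation algorithm computes a set $F$ of non-edges of total cost at most $\alpha\cdot B$ such that the diameter of $(V,E\cup F)$ is at most $\beta\cdot D^B_{opt}$. *)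

theory Defs
  imports Main "HOL-Library.Extended_Nat"
begin

section \<open>Bounded Cost Minimum Diameter Edge Addition\<close>

text \<open>
  An undirected graph is a vertex set \<open>V\<close> with a set \<open>E \<subseteq> pairs V\<close> of unordered pairs. Weight and
  cost functions are only ever applied to members of \<open>pairs V\<close>; their values on other sets are
  irrelevant.
\<close>

definition pairs :: "'a set \<Rightarrow> 'a set set" where
  "pairs V = {e. e \<subseteq> V \<and> card e = 2}"

definition non_edges :: "'a set \<Rightarrow> 'a set set \<Rightarrow> 'a set set" where
  "non_edges V E = pairs V - E"

fun path_edges :: "'a list \<Rightarrow> 'a set list" where
  "path_edges (u # v # p) = {u, v} # path_edges (v # p)"
| "path_edges _ = []"

definition paths :: "'a set \<Rightarrow> 'a set set \<Rightarrow> 'a \<Rightarrow> 'a \<Rightarrow> 'a list set" where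
  "paths V E u v = {p. p \<noteq> [] \<and> hd p = u \<and> last p = v \<and> distinct p \<and> set p \<subseteq> V
                       \<and> set (path_edges p) \<subseteq> E}"

definition path_weight :: "('a set \<Rightarrow> nat) \<Rightarrow> 'a list \<Rightarrow> nat" where
  "path_weight w p = sum_list (map w (path_edges p))"

text \<open>Vertices in different components are at distance \<open>\<infinity>\<close>, the infimum of the empty set.\<close>

definition distance :: "'a set \<Rightarrow> 'a set set \<Rightarrow> ('a set \<Rightarrow> nat) \<Rightarrow> 'a \<Rightarrow> 'a \<Rightarrow> enat" where
  "distance V E w u v = (INF p \<in> paths V E u v. enat (path_weight w p))"

definition diameter :: "'a set \<Rightarrow> 'a set set \<Rightarrow> ('a set \<Rightarrow> nat) \<Rightarrow> enat" where
  "diameter V E w = (SUP u \<in> V. SUP v \<in> V. distance V E w u v)"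

definition feasible ::
  "'a set \<Rightarrow> 'a set set \<Rightarrow> ('a set \<Rightarrow> nat) \<Rightarrow> nat \<Rightarrow> 'a set set set" where
  "feasible V E c B = {F. F \<subseteq> non_edges V E \<and> sum c F \<le> B}"

text \<open>For finite \<open>V\<close> the infimum is a minimum, as \<open>{}\<close> is always feasible.\<close>

definition D_opt ::
  "'a set \<Rightarrow> 'a set set \<Rightarrow> ('a set \<Rightarrow> nat) \<Rightarrow> ('a set \<Rightarrow> nat) \<Rightarrow> nat \<Rightarrow> enat" where
  "D_opt V E w c B = (INF F \<in> feasible V E c B. diameter V (E \<union> F) w)"

definition approx_solution ::
  "nat \<Rightarrow> nat \<Rightarrow> 'a set \<Rightarrow> 'a set set \<Rightarrow> ('a set \<Rightarrow> nat) \<Rightarrow> ('a set \<Rightarrow> nat) \<Rightarrow> nat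
    \<Rightarrow> 'a set set \<Rightarrow> bool" where
  "approx_solution \<alpha> \<beta> V E w c B F \<longleftrightarrow>
     F \<subseteq> non_edges V E \<and> sum c F \<le> \<alpha> * B \<and>
     diameter V (E \<union> F) w \<le> enat \<beta> * D_opt V E w c B"


section \<open>Programs and their running time\<close>

text \<open>
  The machine model is the additive unit-cost RAM of Cook and Reckhow, presented as a structured
  language. Memory cells hold natural numbers; addition, truncated subtraction, comparison, and
  (indirect) reading and writing of a cell each take one step. There is no multiplication, so a
  step lengthens numbers by at most one bit, which is what keeps unit cost meaningful on unbounded
  numbers. The memory is split into named arrays, only finitely many of which occur in a program:
  interleaving them in a single memory costs a constant factor. Scalar variables are arrays used
  at index 0 only.
\<close>

type_synonym vname = string
type_synonym state = "vname \<Rightarrow> nat \<Rightarrow> nat"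

datatype aexp = N nat | Read vname aexp | Plus aexp aexp | Minus aexp aexp

datatype bexp = Bc bool | Not bexp | And bexp bexp | Less aexp aexp

datatype com =
    Skip
  | Write vname aexp aexp  \<comment> \<open>\<open>Write x i a\<close> is the assignment \<open>x[i] := a\<close>\<close>
  | Seq com com
  | If bexp com com
  | While bexp com

fun aval :: "aexp \<Rightarrow> state \<Rightarrow> nat" where
  "aval (N m) s = m"
| "aval (Read x i) s = s x (aval i s)"
| "aval (Plus a b) s = aval a s + aval b s"
| "aval (Minus a b) s = aval a s - aval b s"

fun bval :: "bexp \<Rightarrow> state \<Rightarrow> bool" where
  "bval (Bc b) s \<longleftrightarrow> b"
| "bval (Not b) s \<longleftrightarrow> \<not> bval b s"
| "bval (And b c) s \<longleftrightarrow> bval b s \<and> bval c s"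
| "bval (Less a b) s \<longleftrightarrow> aval a s < aval b s"

fun acost :: "aexp \<Rightarrow> nat" where
  "acost (N m) = 1"
| "acost (Read x i) = acost i + 1"
| "acost (Plus a b) = acost a + acost b + 1"
| "acost (Minus a b) = acost a + acost b + 1"

fun bcost :: "bexp \<Rightarrow> nat" where
  "bcost (Bc b) = 1"
| "bcost (Not b) = bcost b + 1"
| "bcost (And b c) = bcost b + bcost c + 1"
| "bcost (Less a b) = acost a + acost b + 1"

text \<open>\<open>exec p s t s'\<close>: started in \<open>s\<close>, the program \<open>p\<close> halts in \<open>s'\<close> after exactly \<open>t\<close> steps.\<close>

inductive exec :: "com \<Rightarrow> state \<Rightarrow> nat \<Rightarrow> state \<Rightarrow> bool" where
  Skip: "exec Skip s 1 s"
| Write: "exec (Write x i a) s (acost i + acost a + 1) (s(x := (s x)(aval i s := aval a s)))"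
| Seq: "exec p s t s' \<Longrightarrow> exec q s' t' s'' \<Longrightarrow> exec (Seq p q) s (t + t') s''"
| IfTrue: "bval b s \<Longrightarrow> exec p s t s' \<Longrightarrow> exec (If b p q) s (bcost b + 1 + t) s'"
| IfFalse: "\<not> bval b s \<Longrightarrow> exec q s t s' \<Longrightarrow> exec (If b p q) s (bcost b + 1 + t) s'"
| WhileFalse: "\<not> bval b s \<Longrightarrow> exec (While b p) s (bcost b + 1) s"
| WhileTrue: "bval b s \<Longrightarrow> exec p s t s' \<Longrightarrow> exec (While b p) s' t' s''
    \<Longrightarrow> exec (While b p) s (bcost b + 1 + t + t') s''"

inductive_cases SkipE: "exec Skip s t s'"
inductive_cases WriteE: "exec (Write x i a) s t s'"
inductive_cases SeqE: "exec (Seq p q) s t s'"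
inductive_cases IfE: "exec (If b p q) s t s'"
inductive_cases WhileE: "exec (While b p) s t s'"

text \<open>Hence a halting run on an input is \<^emph>\<open>the\<close> run, and its step count is \<^emph>\<open>the\<close> running time.\<close>

lemma exec_deterministic:
  "exec p s t s' \<Longrightarrow> exec p s u r \<Longrightarrow> t = u \<and> s' = r"
proof (induction arbitrary: u r rule: exec.induct)
  case (Skip s)
  then show ?case by (auto elim: SkipE)
next
  case (Write x i a s)
  then show ?case by (auto elim: WriteE)
next
  case (Seq p s t s' q t' s'')
  obtain t1 s1 t2 where "exec p s t1 s1" "exec q s1 t2 r" "u = t1 + t2"
    using Seq.prems by (rule SeqE)
  with Seq.IH show ?case by metis
next
  case (IfTrue b s p t s' q)
  obtain t1 where "exec p s t1 r" "u = bcost b + 1 + t1"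
    using IfTrue.prems by (rule IfE) (use IfTrue.hyps in simp_all)
  with IfTrue.IH show ?case by metis
next
  case (IfFalse b s q t s' p)
  obtain t1 where "exec q s t1 r" "u = bcost b + 1 + t1"
    using IfFalse.prems by (rule IfE) (use IfFalse.hyps in simp_all)
  with IfFalse.IH show ?case by metis
next
  case (WhileFalse b s p)
  then show ?case by (auto elim: WhileE)
next
  case (WhileTrue b s p t s' t' s'')
  obtain t1 s1 t2 where "exec p s t1 s1" "exec (While b p) s1 t2 r" "u = bcost b + 1 + t1 + t2"
    using WhileTrue.prems by (rule WhileE) (use WhileTrue.hyps in simp_all)
  with WhileTrue.IH show ?case by metis
qed


section \<open>Input and output of unit-cost instances\<close>

text \<open>
  The vertices are \<open>0, \<dots>, n - 1\<close>. A function on pairs of vertices is stored as an \<open>n \<times> n\<close> matrix in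
  row-major order, with zeros on the diagonal.
\<close>

definition matrix :: "nat \<Rightarrow> (nat set \<Rightarrow> nat) \<Rightarrow> nat \<Rightarrow> nat" where
  "matrix n f m =
     (if m < n * n \<and> m div n \<noteq> m mod n then f {m div n, m mod n} else 0)"

definition input_state ::
  "nat \<Rightarrow> nat \<Rightarrow> nat set set \<Rightarrow> (nat set \<Rightarrow> nat) \<Rightarrow> state" where
  "input_state n k E w = (\<lambda>_ _. 0)
     (''n'' := (\<lambda>_. 0)(0 := n),
      ''k'' := (\<lambda>_. 0)(0 := k),
      ''E'' := matrix n (\<lambda>e. of_bool (e \<in> E)),
      ''w'' := matrix n w)"

definition outputs :: "state \<Rightarrow> nat \<Rightarrow> nat set set \<Rightarrow> bool" where
  "outputs s n F \<longleftrightarrow> (\<forall>m < n * n. s ''F'' m = matrix n (\<lambda>e. of_bool (e \<in> F)) m)"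

end

theory Submission
  imports Defs
begin

text \<open>
  Let \<open>F\<close> be an optimal set of at most \<open>k\<close> new edges and \<open>D\<close> the resulting diameter. A shortest path
  from \<open>x\<close> to \<open>y\<close> in the optimal graph either avoids \<open>F\<close> or has a type \<open>(a, b)\<close>: its first edge of
  \<open>F\<close> starts in \<open>a\<close>, its last one ends in \<open>b\<close>, and it runs through \<open>G\<close> before \<open>a\<close> and after \<open>b\<close>.
  If the pairs \<open>(x, y)\<close> and \<open>(u, v)\<close> have the same type and some path of weight at most \<open>D\<close> between
  \<open>x\<close> and \<open>y\<close> has been added to \<open>G\<close>, then the walk from \<open>u\<close> to \<open>v\<close> by way of \<open>a\<close>, \<open>x\<close>, \<open>y\<close>, \<open>b\<close> has
  weight at most \<open>3 D\<close>; a reversed type serves as well. For a fixed \<open>a\<close>, every edge of \<open>F\<close> can be the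
  last one in one direction only, as the distance from \<open>a\<close> increases along it; so there are at most
  \<open>2k \<cdot> k\<close> ordered types, that is, \<open>k\<^sup>2\<close> up to reversal.

  The greedy algorithm therefore repeats \<open>k\<^sup>2\<close> times: take a pair that is farthest apart according to
  the detours known so far, and add the at most \<open>k\<close> non-edges of a path between them that is lightest
  among the paths with at most \<open>k\<close> non-edges; its weight is at most \<open>D\<close>. If some pair were still more
  than \<open>3 D\<close> apart at the end, it and the chosen pairs would have \<open>k\<^sup>2 + 1\<close> different types. The paths
  come from \<open>k\<close> min-plus products after a Floyd-Warshall computation, in time \<open>O(k n\<^sup>3)\<close>. A round costs
  \<open>O(n\<^sup>2)\<close>, which suffices for \<open>k < n\<close>; for \<open>k \<ge> n\<close> all non-edges fit into the budget.
\<close>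

section \<open>Walks and distances\<close>

text \<open>Walks may repeat vertices, so they concatenate freely, unlike the simple paths behind
  \<open>distance\<close>. With the weight as an argument of the predicate, no vertex lists have to
  be carried along.\<close>

inductive walk :: "'a set \<Rightarrow> 'a set set \<Rightarrow> ('a set \<Rightarrow> nat) \<Rightarrow> 'a \<Rightarrow> 'a \<Rightarrow> nat \<Rightarrow> bool" for V A w where
  Nil: "x \<in> V \<Longrightarrow> walk V A w x x 0"
| Cons: "x \<in> V \<Longrightarrow> {x, z} \<in> A \<Longrightarrow> walk V A w z y c \<Longrightarrow> walk V A w x y (w {x, z} + c)"

lemma walk_endpoints: "walk V A w x y c \<Longrightarrow> x \<in> V \<and> y \<in> V"
  by (induction rule: walk.induct) auto

lemma walk_trans: "walk V A w x y c \<Longrightarrow> walk V A w y z c' \<Longrightarrow> walk V A w x z (c + c')"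
proof (induction rule: walk.induct)
  case (Cons x u y c)
  then show ?case using walk.Cons[of x V u A w z "c + c'"] by (simp add: add.assoc)
qed simp

lemma walk_edge: "x \<in> V \<Longrightarrow> y \<in> V \<Longrightarrow> {x, y} \<in> A \<Longrightarrow> walk V A w x y (w {x, y})"
  using walk.Cons[of x V y A w y 0] walk.Nil[of y V] by simp

lemma walk_sym: "walk V A w x y c \<Longrightarrow> walk V A w y x c"
proof (induction rule: walk.induct)
  case (Nil x)
  then show ?case by (rule walk.Nil)
next
  case (Cons x z y c)
  then have "walk V A w z x (w {x, z})"
    using walk_edge[of z V x A w] walk_endpoints[OF Cons.IH] by (simp add: insert_commute)
  from walk_trans[OF Cons.IH this] show ?case by (simp add: add.commute)
qed

lemma walk_mono: "walk V A w x y c \<Longrightarrow> A \<subseteq> B \<Longrightarrow> walk V B w x y c"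
  by (induction rule: walk.induct) (auto intro: walk.intros)

section \<open>Passage between walks and simple paths\<close>

lemma path_edges_append:
  "path_edges (p @ x # q) = path_edges (p @ [x]) @ path_edges (x # q)"
proof (induction p rule: path_edges.induct)
  case ("2_2" v)
  then show ?case by (cases q) auto
qed auto

lemma path_edges_Cons: "p \<noteq> [] \<Longrightarrow> path_edges (x # p) = {x, hd p} # path_edges p"
  by (cases p) auto

lemma path_edges_subset: "e \<in> set (path_edges p) \<Longrightarrow> e \<subseteq> set p"
  by (induction p rule: path_edges.induct) auto

text \<open>The first vertex of an edge is absent from the rest of the path, hence so is the
  edge.\<close>

lemma distinct_path_edges: "distinct p \<Longrightarrow> distinct (path_edges p)"
proof (induction p rule: path_edges.induct)
  case (1 u v p)
  then show ?case using path_edges_subset[of "{u, v}" "v # p"] by auto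
qed auto

lemma path_imp_walk:
  "p \<noteq> [] \<Longrightarrow> set p \<subseteq> V \<Longrightarrow> set (path_edges p) \<subseteq> A \<Longrightarrow>
   walk V A w (hd p) (last p) (path_weight w p)"
proof (induction p rule: path_edges.induct)
  case (1 u v p)
  then show ?case
    using walk.Cons[of u V v A w "last (v # p)" "path_weight w (v # p)"]
    by (simp add: path_weight_def)
qed (auto simp: path_weight_def intro: walk.Nil)

text \<open>If the new first vertex already lies on the path, dropping everything before its
  occurrence removes a cycle and cannot increase the weight.\<close>

lemma walk_imp_path: "walk V A w x y c \<Longrightarrow> \<exists>p \<in> paths V A x y. path_weight w p \<le> c"
proof (induction rule: walk.induct)
  case (Nil x)
  then show ?case by (intro bexI[of _ "[x]"]) (auto simp: paths_def path_weight_def)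
next
  case (Cons x z y c)
  then obtain p where p: "p \<in> paths V A z y" "path_weight w p \<le> c" by blast
  show ?case
  proof (cases "x \<in> set p")
    case True
    then obtain p1 p2 where "p = p1 @ x # p2" by (meson split_list)
    with p show ?thesis
      by (intro bexI[of _ "x # p2"])
         (auto simp: paths_def path_weight_def path_edges_append[of p1 x p2])
  next
    case False
    with p Cons.hyps show ?thesis
      by (intro bexI[of _ "x # p"]) (auto simp: paths_def path_weight_def path_edges_Cons)
  qed
qed

lemma distance_le_iff: "distance V A w x y \<le> enat c \<longleftrightarrow> (\<exists>c' \<le> c. walk V A w x y c')"
proof
  assume le: "distance V A w x y \<le> enat c"
  \<comment> \<open>A finite bound excludes the empty infimum, which is \<infinity>; a nonempty
    infimum is attained because \<open>enat\<close> is well-ordered.\<close>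
  then have "paths V A x y \<noteq> {}" by (auto simp: distance_def Inf_enat_def)
  then have "distance V A w x y \<in> (\<lambda>p. enat (path_weight w p)) ` paths V A x y"
    unfolding distance_def by (auto intro!: wellorder_InfI)
  then obtain p where "p \<in> paths V A x y" "distance V A w x y = enat (path_weight w p)" by blast
  with le path_imp_walk[of p V A w] show "\<exists>c' \<le> c. walk V A w x y c'"
    by (auto simp: paths_def)
next
  assume "\<exists>c' \<le> c. walk V A w x y c'"
  then obtain p where "p \<in> paths V A x y" "path_weight w p \<le> c"
    using walk_imp_path by (metis order_trans)
  then show "distance V A w x y \<le> enat c"
    unfolding distance_def by (intro INF_lower2[of p]) auto
qed

lemma diameter_le_iff:
  "diameter V A w \<le> enat c \<longleftrightarrow> (\<forall>x \<in> V. \<forall>y \<in> V. \<exists>c' \<le> c. walk V A w x y c')"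
  by (simp add: diameter_def SUP_le_iff distance_le_iff)

text \<open>One walk is cut in two ways: at its last edge of \<open>F\<close>, which leaves the
  middle piece \<open>c3\<close>, and at its first edge of \<open>F\<close>, which leaves
  \<open>c4\<close>. Both cuts share the outer pieces \<open>c1\<close> and \<open>c2\<close> in
  \<open>E\<close>; on a lightest walk this makes both the first and the last edge of
  \<open>F\<close> tight.\<close>

lemma walk_decompose:
  "walk V (E \<union> F) w x y c \<Longrightarrow> walk V E w x y c \<or>
    (\<exists>a a' b' b c1 c2 c3 c4. {a, a'} \<in> F \<and> {b', b} \<in> F \<and> walk V E w x a c1 \<and> walk V E w b y c2 \<and>
       walk V (E \<union> F) w a b' c3 \<and> walk V (E \<union> F) w a' b c4 \<and>
       c = c1 + c3 + w {b', b} + c2 \<and> c = c1 + w {a, a'} + c4 + c2)"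
proof (induction rule: walk.induct)
  case (Nil x)
  then show ?case by (auto intro: walk.Nil)
next
  case (Cons x z y c)
  have z: "z \<in> V" using walk_endpoints[OF Cons.hyps(3)] ..
  from Cons.IH show ?case
  proof (elim disjE exE conjE)
    assume W: "walk V E w z y c"
    show ?thesis
    proof (cases "{x, z} \<in> E")
      case True
      then show ?thesis using W Cons.hyps walk.Cons[of x V z E w y c] by auto
    next
      case False
      then have "{x, z} \<in> F" using Cons.hyps by auto
      \<comment> \<open>The only edge of \<open>F\<close> is both the first and the last:
        \<open>a = b' = x\<close>, \<open>a' = b = z\<close>, and the middle pieces are
        empty.\<close>
      then show ?thesis using W z Cons.hyps(1)
        by (intro disjI2 exI[of _ x] exI[of _ z] exI[of _ "0::nat"] exI[of _ c]
            exI[of _ "0::nat"] exI[of _ "0::nat"] conjI)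
           (simp_all add: walk.Nil)
    qed
  next
    fix a a' b' b c1 c2 c3 c4
    assume *: "{a, a'} \<in> F" "{b', b} \<in> F" "walk V E w z a c1" "walk V E w b y c2"
       "walk V (E \<union> F) w a b' c3" "walk V (E \<union> F) w a' b c4"
       "c = c1 + c3 + w {b', b} + c2" "c = c1 + w {a, a'} + c4 + c2"
    show ?thesis
    proof (cases "{x, z} \<in> E")
      case True
      have xa: "walk V E w x a (w {x, z} + c1)" by (rule walk.Cons[OF Cons.hyps(1) True *(3)])
      show ?thesis
        by (intro disjI2 exI[of _ a] exI[of _ a'] exI[of _ b'] exI[of _ b]
            exI[of _ "w {x, z} + c1"] exI[of _ c2] exI[of _ c3] exI[of _ c4] conjI)
          (rule *(1,2,4-6) xa | use *(7,8) in linarith)+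
    next
      case False
      then have xz: "{x, z} \<in> F" using Cons.hyps by auto
      \<comment> \<open>The new edge becomes the first edge of \<open>F\<close>. The former initial
        piece in \<open>E\<close> is absorbed into both middle pieces; the last edge of
        \<open>F\<close> stays.\<close>
      have za: "walk V (E \<union> F) w z a c1" by (rule walk_mono[OF *(3)]) simp
      have 1: "walk V (E \<union> F) w z b' (c1 + c3)" using walk_trans[OF za *(5)] .
      have 2: "walk V (E \<union> F) w x b' (w {x, z} + (c1 + c3))"
        using Cons.hyps(1,2) 1 by (rule walk.Cons)
      have "b' \<in> V" "b \<in> V" using walk_endpoints[OF *(5)] walk_endpoints[OF *(6)] by auto
      then have 3: "walk V (E \<union> F) w z b (c1 + c3 + w {b', b})"
        using walk_trans[OF 1 walk_edge[of b' V b "E \<union> F" w]] *(2) by simp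
      show ?thesis
        by (intro disjI2 exI[of _ x] exI[of _ z] exI[of _ b'] exI[of _ b] exI[of _ "0::nat"]
            exI[of _ c2] exI[of _ "w {x, z} + (c1 + c3)"] exI[of _ "c1 + c3 + w {b', b}"] conjI)
           (rule xz *(2,4) 2 3 walk.Nil Cons.hyps(1) | use *(7) in linarith)+
    qed
  qed
qed

section \<open>Weights with tie-breaking\<close>

lemma path_weight_tie_break:
  "path_weight (\<lambda>e. M * w e + of_bool (e \<in> F)) p =
   M * path_weight w p + length (filter (\<lambda>e. e \<in> F) (path_edges p))"
proof -
  have "(\<Sum>e\<leftarrow>es. M * w e + of_bool (e \<in> F)) = M * sum_list (map w es) + length (filter (\<lambda>e. e \<in> F) es)"
    for es by (induction es) (auto simp: algebra_simps)
  then show ?thesis by (simp add: path_weight_def)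
qed

lemma length_filter_path_edges:
  assumes "distinct p" "finite F"
  shows "length (filter (\<lambda>e. e \<in> F) (path_edges p)) \<le> card F"
proof -
  have "length (filter (\<lambda>e. e \<in> F) (path_edges p)) = card (set (filter (\<lambda>e. e \<in> F) (path_edges p)))"
    using assms distinct_path_edges by (metis distinct_card distinct_filter)
  also have "\<dots> \<le> card F" using assms by (intro card_mono) auto
  finally show ?thesis .
qed

lemma walk_unscale:
  "walk V E (\<lambda>e. M * w e + of_bool (e \<in> F)) x y c \<Longrightarrow> E \<inter> F = {} \<Longrightarrow>
   \<exists>c'. walk V E w x y c' \<and> c = M * c'"
proof (induction rule: walk.induct)
  case (Nil x)
  then show ?case by (auto intro: walk.Nil)
next
  case (Cons x z y c)
  then obtain c' where "walk V E w z y c'" "c = M * c'" by auto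
  moreover have "{x, z} \<notin> F" using Cons by auto
  ultimately show ?case using Cons.hyps
    by (intro exI[of _ "w {x, z} + c'"]) (simp add: walk.Cons distrib_left)
qed

lemma pairsE:
  assumes "e \<in> pairs V" obtains x y where "x \<in> V" "y \<in> V" "x \<noteq> y" "e = {x, y}"
  using assms by (auto simp: pairs_def card_2_iff)

lemma finite_pairs: "finite V \<Longrightarrow> finite (pairs V)"
  by (rule finite_subset[of _ "Pow V"]) (auto simp: pairs_def)

section \<open>Types of pairs in an optimal solution\<close>

text \<open>Membership in \<open>T\<close> records only that some edge of \<open>F\<close> can end,
  and some edge of \<open>F\<close> can start, a lightest walk from \<open>a\<close> to
  \<open>b\<close>. This condition is symmetric, and it is what the counting needs: distances from
  \<open>a\<close> strictly increase along such a last edge, so the edge determines \<open>b\<close>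
  once \<open>a\<close> is fixed.\<close>

lemma endpoint_types:
  fixes w :: "'a set \<Rightarrow> nat"
  assumes V: "finite V" and F: "F \<subseteq> pairs V" "E \<inter> F = {}" "card F \<le> k"
    and D: "diameter V (E \<union> F) w \<le> enat D"
  obtains T where "finite T" "sym T" "irrefl T" "card T \<le> 2 * k * k"
    "\<And>x y. x \<in> V \<Longrightarrow> y \<in> V \<Longrightarrow> (\<exists>c \<le> D. walk V E w x y c) \<or>
       (\<exists>a b c1 c2. (a, b) \<in> T \<and> walk V E w x a c1 \<and> walk V E w b y c2 \<and> c1 + c2 \<le> D)"
proof -
  have finF: "finite F" using F V finite_pairs finite_subset by blast
  \<comment> \<open>A simple path collects at most \<open>k\<close> tie-breaking units. With
    \<open>M = k + 1\<close>, a multiple \<open>M * c\<close> bounded by \<open>M * D + k\<close>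
    therefore still gives \<open>c \<le> D\<close>.\<close>
  define M where "M = Suc k"
  \<comment> \<open>Breaking ties by the number of edges of \<open>F\<close> makes every edge of \<open>F\<close> strictly positive.\<close>
  define w' where "w' = (\<lambda>e. M * w e + of_bool (e \<in> F))"
  define \<delta> where "\<delta> x y = (LEAST c. walk V (E \<union> F) w' x y c)" for x y
  have ex: "\<exists>c \<le> M * D + k. walk V (E \<union> F) w' x y c" if "x \<in> V" "y \<in> V" for x y
  proof -
    obtain c where "c \<le> D" "walk V (E \<union> F) w x y c" using D \<open>x \<in> V\<close> \<open>y \<in> V\<close> by (auto simp: diameter_le_iff)
    then obtain p where p: "p \<in> paths V (E \<union> F) x y" "path_weight w p \<le> D"
      using walk_imp_path by (metis order_trans)
    have "path_weight w' p \<le> M * D + k"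
      unfolding w'_def path_weight_tie_break
      using p length_filter_path_edges[OF _ finF, of p] F(3)
      by (intro add_mono mult_le_mono) (auto simp: paths_def)
    moreover have "walk V (E \<union> F) w' x y (path_weight w' p)"
      using p path_imp_walk[of p V "E \<union> F" w'] by (auto simp: paths_def)
    ultimately show ?thesis by blast
  qed
  have \<delta>: "walk V (E \<union> F) w' x y (\<delta> x y)" if "x \<in> V" "y \<in> V" for x y
    unfolding \<delta>_def using ex[OF that] by (meson LeastI)
  have \<delta>_le: "\<delta> x y \<le> c" if "walk V (E \<union> F) w' x y c" for x y c
    unfolding \<delta>_def using that by (rule Least_le)
  have \<delta>_sym: "\<delta> x y = \<delta> y x" for x y
    unfolding \<delta>_def by (rule arg_cong[where f = Least]) (auto intro: walk_sym)
  have unscale: "\<exists>c'. walk V E w x y c' \<and> c = M * c'" if "walk V E w' x y c" for x y c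
    using walk_unscale[OF that[unfolded w'_def] F(2)] .
  have edge: "{x, y} \<in> F \<Longrightarrow> x \<in> V \<and> y \<in> V" for x y
    using F(1) by (auto simp: pairs_def)
  have w'_pos: "{x, y} \<in> F \<Longrightarrow> 0 < w' {x, y}" for x y by (simp add: w'_def)
  \<comment> \<open>\<open>R a b b'\<close> says that the edge \<open>{b', b}\<close> of
    \<open>F\<close> can end a lightest walk from \<open>a\<close> to \<open>b\<close>.\<close>
  define R where "R a b b' \<longleftrightarrow> {b', b} \<in> F \<and> \<delta> a b = \<delta> a b' + w' {b', b}" for a b b'
  define T where "T = {(a, b). a \<in> V \<and> b \<in> V \<and> (\<exists>b'. R a b b') \<and> (\<exists>a'. R b a a')}"
  have "T \<subseteq> V \<times> V" by (auto simp: T_def)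
  then have finT: "finite T" using V by (meson finite_SigmaI finite_subset)
  have "sym T" by (auto simp: T_def sym_def)
  have "irrefl T"
  proof (rule irreflI, rule notI)
    fix a assume "(a, a) \<in> T"
    then obtain b' where "a \<in> V" "R a a b'" by (auto simp: T_def)
    moreover have "\<delta> a a = 0" using \<delta>_le[OF walk.Nil[OF \<open>a \<in> V\<close>]] by simp
    ultimately show False using w'_pos[of b' a] by (auto simp: R_def)
  qed
  \<comment> \<open>One such last edge is chosen for every type. This injects \<open>T\<close> into
    (endpoints of \<open>F\<close>) times \<open>F\<close>, a set of at most \<open>2k * k\<close>
    elements.\<close>
  define f where "f = (\<lambda>(a, b). (a, {SOME b'. R a b b', b}))"
  have R_some: "R a b (SOME b'. R a b b')" if "(a, b) \<in> T" for a b
    using that by (auto simp: T_def intro: someI_ex)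
  have "inj_on f T"
  proof (rule inj_onI)
    fix s t assume st: "s \<in> T" "t \<in> T" "f s = f t"
    obtain a b where s: "s = (a, b)" by fastforce
    obtain c where t: "t = (a, c)" using st(3) s by (cases t) (auto simp: f_def)
    define b' where "b' = (SOME b'. R a b b')"
    define c' where "c' = (SOME b'. R a c b')"
    have "R a b b'" "R a c c'" using R_some st s t by (auto simp: b'_def c'_def)
    moreover have "{b', b} = {c', c}" using st(3) by (auto simp: f_def s t b'_def c'_def)
    \<comment> \<open>Otherwise one edge would be used in both directions from \<open>a\<close>, and
      the distance from \<open>a\<close> would strictly increase both ways.\<close>
    moreover have False if "b = c'" "c = b'"
      using that \<open>R a b b'\<close> \<open>R a c c'\<close> w'_pos[of b' b] by (auto simp: R_def insert_commute)
    ultimately have "b = c" by (metis doubleton_eq_iff)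
    then show "s = t" using s t by simp
  qed
  moreover have "f ` T \<subseteq> \<Union>F \<times> F"
  proof
    fix z assume "z \<in> f ` T"
    then obtain a b where ab: "(a, b) \<in> T" "z = (a, {SOME b'. R a b b', b})" by (auto simp: f_def)
    have "R b a (SOME b'. R b a b')" using R_some \<open>sym T\<close> ab(1) by (meson symE)
    then have "a \<in> \<Union>F" unfolding R_def by blast
    moreover have "{SOME b'. R a b b', b} \<in> F" using R_some[OF ab(1)] by (simp add: R_def)
    ultimately show "z \<in> \<Union>F \<times> F" using ab by simp
  qed
  moreover have "finite (\<Union>F)" using V F(1) by (auto intro!: finite_subset[OF _ V] simp: pairs_def)
  ultimately have "card T \<le> card (\<Union>F \<times> F)" using finF by (intro card_inj_on_le) auto
  also have "\<dots> = card (\<Union>F) * card F" by (rule card_cartesian_product)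
  also have "\<dots> \<le> (2 * k) * k"
  proof (rule mult_le_mono)
    have "card (\<Union>F) \<le> sum card F"
      by (rule card_Union_le_sum_card)
    also have "\<dots> = (\<Sum>e\<in>F. 2)" using F(1) by (intro sum.cong) (auto simp: pairs_def)
    also have "\<dots> \<le> 2 * k" using F(3) by simp
    finally show "card (\<Union>F) \<le> 2 * k" .
  qed (use F in auto)
  finally have cardT: "card T \<le> 2 * k * k" .
  have main: "(\<exists>c \<le> D. walk V E w x y c) \<or>
       (\<exists>a b c1 c2. (a, b) \<in> T \<and> walk V E w x a c1 \<and> walk V E w b y c2 \<and> c1 + c2 \<le> D)"
    if xy: "x \<in> V" "y \<in> V" for x y
  proof -
    have le: "\<delta> x y \<le> M * D + k" using ex[OF xy] \<delta>_le by (meson order_trans)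
    have scale: "c \<le> D" if "M * c \<le> M * D + k" for c
    proof (rule ccontr)
      assume "\<not> c \<le> D"
      then have "M * Suc D \<le> M * c" by (intro mult_le_mono) auto
      then show False using that by (simp add: M_def)
    qed
    from walk_decompose[OF \<delta>[OF xy]] show ?thesis
    proof (elim disjE exE conjE)
      assume "walk V E w' x y (\<delta> x y)"
      then obtain c where "walk V E w x y c" "\<delta> x y = M * c"
        using unscale[of x y] by blast
      then show ?thesis using scale le by auto
    next
      fix a a' b' b c1 c2 c3 c4
      assume *: "{a, a'} \<in> F" "{b', b} \<in> F" "walk V E w' x a c1" "walk V E w' b y c2"
        "walk V (E \<union> F) w' a b' c3" "walk V (E \<union> F) w' a' b c4"
        "\<delta> x y = c1 + c3 + w' {b', b} + c2" "\<delta> x y = c1 + w' {a, a'} + c4 + c2"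
      have V4: "a \<in> V" "a' \<in> V" "b' \<in> V" "b \<in> V" using edge[OF *(1)] edge[OF *(2)] by simp_all
      have xa: "walk V (E \<union> F) w' x a c1" and yb: "walk V (E \<union> F) w' b y c2"
        by (rule walk_mono[OF *(3)], simp, rule walk_mono[OF *(4)], simp)
      \<comment> \<open>A lightest walk leaves no slack: together with the two decompositions of its
        weight, the following bounds collapse to equalities, so both end edges are tight.\<close>
      have 1: "\<delta> x y \<le> c1 + \<delta> a b + c2"
        by (rule \<delta>_le, rule walk_trans, rule walk_trans[OF xa \<delta>]) (use V4 yb in auto)
      have 2: "\<delta> a b \<le> \<delta> a b' + w' {b', b}"
        by (rule \<delta>_le, rule walk_trans[OF \<delta> walk_edge]) (use V4 *(2) in auto)
      have 3: "\<delta> a b \<le> w' {a, a'} + \<delta> a' b"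
        by (rule \<delta>_le, rule walk_trans[OF walk_edge \<delta>]) (use V4 *(1) in auto)
      have 4: "\<delta> a b' \<le> c3" "\<delta> a' b \<le> c4" by (rule \<delta>_le[OF *(5)], rule \<delta>_le[OF *(6)])
      have eq: "\<delta> a b = \<delta> a b' + w' {b', b}" "\<delta> a b = w' {a, a'} + \<delta> a' b"
        using 1 2 3 4 *(7,8) by linarith+
      have "R a b b'" using *(2) eq by (simp add: R_def)
      moreover have "R b a a'"
        using *(1) eq \<delta>_sym[of a b] \<delta>_sym[of a' b] by (simp add: R_def insert_commute)
      ultimately have "(a, b) \<in> T" using V4 by (auto simp: T_def)
      moreover obtain d1 where d1: "walk V E w x a d1" "c1 = M * d1"
        using unscale[OF *(3)] by metis
      moreover obtain d2 where d2: "walk V E w b y d2" "c2 = M * d2"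
        using unscale[OF *(4)] by metis
      moreover have "d1 + d2 \<le> D"
      proof (rule scale)
        have "c1 + c2 \<le> M * D + k" using le *(7) by linarith
        then show "M * (d1 + d2) \<le> M * D + k" by (simp only: d1(2) d2(2) distrib_left)
      qed
      ultimately show ?thesis by metis
    qed
  qed
  show thesis using that[OF finT \<open>sym T\<close> \<open>irrefl T\<close> cardT] main by blast
qed

section \<open>Min-plus products and the Floyd-Warshall recursion\<close>

text \<open>\<open>P\<close> records minimizers, from which walks are rebuilt later. Only indices
  below \<open>n\<close> are constrained because the tables will be blocks of memory.\<close>

definition min_plus ::
  "nat \<Rightarrow> (nat \<Rightarrow> nat \<Rightarrow> nat) \<Rightarrow> (nat \<Rightarrow> nat \<Rightarrow> nat) \<Rightarrow> (nat \<Rightarrow> nat \<Rightarrow> nat) \<Rightarrow> (nat \<Rightarrow> nat \<Rightarrow> nat) \<Rightarrow> bool"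
  where "min_plus n A B C P \<longleftrightarrow> (\<forall>x < n. \<forall>y < n. P x y < n \<and> C x y = A x (P x y) + B (P x y) y \<and>
           (\<forall>m < n. C x y \<le> A x m + B m y))"

lemma min_plusD:
  assumes "min_plus n A B C P" "x < n" "y < n"
  shows "P x y < n" "C x y = A x (P x y) + B (P x y) y" "m < n \<Longrightarrow> C x y \<le> A x m + B m y"
  using assms unfolding min_plus_def by blast+

lemma min_plus_cong:
  assumes "min_plus n A B C P"
    and "\<And>x y. x < n \<Longrightarrow> y < n \<Longrightarrow> A' x y = A x y" "\<And>x y. x < n \<Longrightarrow> y < n \<Longrightarrow> B' x y = B x y"
      "\<And>x y. x < n \<Longrightarrow> y < n \<Longrightarrow> C' x y = C x y" "\<And>x y. x < n \<Longrightarrow> y < n \<Longrightarrow> P' x y = P x y"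
  shows "min_plus n A' B' C' P'"
  unfolding min_plus_def
proof (intro allI impI)
  fix x y assume "x < n" "y < n"
  with assms(1) show "P' x y < n \<and> C' x y = A' x (P' x y) + B' (P' x y) y \<and> (\<forall>m<n. C' x y \<le> A' x m + B' m y)"
    using assms(2-5) min_plusD[OF assms(1)] by simp
qed

text \<open>The zero diagonal gives a free hop from a vertex to itself, so that \<open>l\<close>
  products allow at most, not exactly, \<open>l\<close> proper hops.\<close>

definition weight0 :: "(nat set \<Rightarrow> nat) \<Rightarrow> nat \<Rightarrow> nat \<Rightarrow> nat" where
  "weight0 w x y = (if x = y then 0 else w {x, y})"

text \<open>\<open>b\<close> stands for infinity: an entry below \<open>b\<close> is realized by a
  walk, whereas an entry equal to \<open>b\<close> is only a lower bound on the weights of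
  walks.\<close>

definition apsp :: "nat \<Rightarrow> nat set set \<Rightarrow> (nat set \<Rightarrow> nat) \<Rightarrow> nat \<Rightarrow> (nat \<Rightarrow> nat \<Rightarrow> nat) \<Rightarrow> bool" where
  "apsp n E w b d \<longleftrightarrow> (\<forall>x < n. \<forall>y < n. d x y \<le> b \<and> (d x y < b \<longrightarrow> walk {0..<n} E w x y (d x y)) \<and>
     (\<forall>c. walk {0..<n} E w x y c \<longrightarrow> d x y \<le> c))"

section \<open>The Floyd-Warshall recursion\<close>

fun floyd :: "(nat \<Rightarrow> nat \<Rightarrow> nat) \<Rightarrow> nat \<Rightarrow> nat \<Rightarrow> nat \<Rightarrow> nat" where
  "floyd d 0 x y = d x y"
| "floyd d (Suc m) x y = min (floyd d m x y) (floyd d m x m + floyd d m m y)"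

lemma floyd_le: "floyd d m x y \<le> d x y"
  by (induction m arbitrary: x y) (auto simp: min.coboundedI1)

text \<open>The triangle inequality through processed vertices replaces the usual description by
  paths with restricted interior vertices. Once all vertices are processed, it bounds the table by
  the weight of any walk, edge by edge.\<close>

lemma floyd_triangle:
  "u < m \<Longrightarrow> floyd d m x y \<le> floyd d m x u + floyd d m u y"
proof (induction m arbitrary: x y)
  case (Suc m)
  show ?case
  proof (cases "u = m")
    case True
    then show ?thesis by (simp add: min_def)
  next
    case False
    then have IH: "floyd d m x y \<le> floyd d m x u + floyd d m u y" for x y
      using Suc by simp
    show ?thesis
      using IH[of x y] IH[of x m] IH[of m y] unfolding floyd.simps min_def by (auto split: if_splits)
  qed
qed simp

text \<open>A sum below \<open>b\<close> has both summands below \<open>b\<close>, so a value below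
  \<open>b\<close> is always composed of entries that are realized by walks.\<close>

lemma floyd_walk:
  assumes d: "\<And>x y. x < n \<Longrightarrow> y < n \<Longrightarrow> d x y < b \<Longrightarrow> walk {0..<n} E w x y (d x y)"
  shows "m \<le> n \<Longrightarrow> x < n \<Longrightarrow> y < n \<Longrightarrow> floyd d m x y < b \<Longrightarrow> walk {0..<n} E w x y (floyd d m x y)"
proof (induction m arbitrary: x y)
  case 0
  then show ?case using d by simp
next
  case (Suc m)
  show ?case
  proof (cases "floyd d m x y \<le> floyd d m x m + floyd d m m y")
    case True
    then show ?thesis using Suc by (simp add: min_def)
  next
    case False
    then have eq: "floyd d (Suc m) x y = floyd d m x m + floyd d m m y" by (simp add: min_def)
    have "walk {0..<n} E w x m (floyd d m x m)" "walk {0..<n} E w m y (floyd d m m y)"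
      using Suc.prems unfolding eq by (auto intro: Suc.IH)
    then show ?thesis unfolding eq by (rule walk_trans)
  qed
qed

lemma apsp_floyd:
  assumes E: "E \<subseteq> pairs {0..<n}" and b: "\<And>x y. x < n \<Longrightarrow> y < n \<Longrightarrow> weight0 w x y \<le> b"
    and d: "\<And>x y. x < n \<Longrightarrow> y < n \<Longrightarrow>
      d x y = (if x = y then 0 else if {x, y} \<in> E then weight0 w x y else b)"
  shows "apsp n E w b (floyd d n)"
proof -
  let ?V = "{0..<n}"
  have "walk ?V E w x y (d x y)" if "x < n" "y < n" "d x y < b" for x y
    using that d[OF that(1,2)] walk_edge[of x ?V y E w] walk.Nil[of x ?V E w]
    by (auto simp: weight0_def split: if_splits)
  then have "walk ?V E w x y (floyd d n x y)" if "x < n" "y < n" "floyd d n x y < b" for x y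
    using floyd_walk[of n d b E w n x y] that by blast
  moreover have "floyd d n x y \<le> b" if "x < n" "y < n" for x y
    using floyd_le[of d n x y] d[OF that] b[OF that] by (auto split: if_splits)
  moreover have "floyd d n x y \<le> c" if "walk ?V E w x y c" for x y c
    using that
  proof (induction rule: walk.induct)
    case (Nil x)
    then show ?case using floyd_le[of d n x x] d[of x x] by simp
  next
    case (Cons x z y c)
    then have xz: "x < n" "z < n" "x \<noteq> z" using E by (auto simp: pairs_def card_insert_if split: if_splits)
    have "floyd d n x y \<le> floyd d n x z + floyd d n z y" using floyd_triangle[OF xz(2)] .
    also have "floyd d n x z \<le> w {x, z}"
      using floyd_le[of d n x z] d[OF xz(1,2)] xz Cons.hyps(2) by (simp add: weight0_def)
    finally show ?case using Cons.IH by simp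
  qed
  ultimately show ?thesis by (auto simp: apsp_def)
qed

section \<open>The greedy choice of paths\<close>

text \<open>
  \<open>P l x y\<close> is the first vertex after the first hop of a lightest walk from \<open>x\<close> to \<open>y\<close> with at most
  \<open>l + 1\<close> hops along arbitrary pairs of vertices, and \<open>Q x m\<close> is where the hop to \<open>m\<close> starts. A hop from
  a vertex to itself stands for no hop, so \<open>route\<close> may contain singletons and edges of \<open>G\<close>; they
  disappear in the intersection with \<open>non_edges\<close>.
\<close>

fun route :: "(nat \<Rightarrow> nat \<Rightarrow> nat \<Rightarrow> nat) \<Rightarrow> (nat \<Rightarrow> nat \<Rightarrow> nat) \<Rightarrow> nat \<Rightarrow> nat \<Rightarrow> nat \<Rightarrow> nat set set" where
  "route P Q 0 x y = {}"
| "route P Q (Suc l) x y = insert {Q x (P l x y), P l x y} (route P Q l (P l x y) y)"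

text \<open>The list holds the chosen pairs, the latest one first.\<close>

fun detour :: "(nat \<Rightarrow> nat \<Rightarrow> nat) \<Rightarrow> (nat \<Rightarrow> nat \<Rightarrow> nat) \<Rightarrow> (nat \<times> nat) list \<Rightarrow> nat \<Rightarrow> nat \<Rightarrow> nat" where
  "detour d L [] u v = d u v"
| "detour d L ((x, y) # ps) u v =
     min (detour d L ps u v) (min (d u x + L x y + d y v) (d u y + L x y + d x v))"

fun greedy :: "nat \<Rightarrow> (nat \<Rightarrow> nat \<Rightarrow> nat) \<Rightarrow> (nat \<Rightarrow> nat \<Rightarrow> nat) \<Rightarrow> (nat \<times> nat) list \<Rightarrow> bool" where
  "greedy n d L [] \<longleftrightarrow> True"
| "greedy n d L ((x, y) # ps) \<longleftrightarrow> x < n \<and> y < n \<and>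
     (\<forall>u < n. \<forall>v < n. detour d L ps u v \<le> detour d L ps x y) \<and> greedy n d L ps"

definition routes where
  "routes P Q k ps = (\<Union>(x, y) \<in> set ps. route P Q k x y)"

lemma card_route: "finite (route P Q l x y) \<and> card (route P Q l x y) \<le> l"
  by (induction l arbitrary: x) (auto intro: card_insert_le_m1)

lemma card_routes: "finite (routes P Q k ps) \<and> card (routes P Q k ps) \<le> length ps * k"
proof (induction ps)
  case (Cons p ps)
  obtain x y where p: "p = (x, y)" by fastforce
  have "routes P Q k (p # ps) = route P Q k x y \<union> routes P Q k ps" by (simp add: routes_def p)
  then show ?case using Cons card_route[of P Q k x y] card_Un_le[of "route P Q k x y" "routes P Q k ps"]
    by simp
qed (simp add: routes_def)

text \<open>A simple path uses each pair at most once. The double sum counts every pair twice, which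
  is generous, but it is the sum over all matrix cells that the program can form directly.\<close>

lemma path_weight_le_sum:
  assumes "distinct p" "set (path_edges p) \<subseteq> pairs {0..<n}"
  shows "path_weight w p \<le> (\<Sum>x<n. \<Sum>y<n. weight0 w x y)"
proof -
  have "path_weight w p = (\<Sum>e\<in>set (path_edges p). w e)"
    unfolding path_weight_def
    using distinct_path_edges[OF assms(1)] by (simp add: sum_list_distinct_conv_sum_set)
  also have "\<dots> \<le> (\<Sum>e\<in>pairs {0..<n}. w e)"
    using assms(2) finite_pairs by (intro sum_mono2) auto
  also have "\<dots> \<le> (\<Sum>e\<in>(\<lambda>(x, y). {x, y}) ` ({..<n} \<times> {..<n} - Id). w e)"
    by (intro sum_mono2) (auto elim!: pairsE)
  also have "\<dots> \<le> (\<Sum>(x, y)\<in>{..<n} \<times> {..<n} - Id. w {x, y})"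
    by (rule order_trans[OF sum_image_le]) (auto simp: case_prod_unfold)
  also have "\<dots> = (\<Sum>(x, y)\<in>{..<n} \<times> {..<n} - Id. weight0 w x y)"
    by (intro sum.cong) (auto simp: weight0_def split: if_splits)
  also have "\<dots> \<le> (\<Sum>(x, y)\<in>{..<n} \<times> {..<n}. weight0 w x y)"
    by (intro sum_mono2) auto
  also have "\<dots> = (\<Sum>x<n. \<Sum>y<n. weight0 w x y)" by (simp add: sum.cartesian_product)
  finally show ?thesis .
qed

lemma detour_antimono: "detour d L (qs @ ps) u v \<le> detour d L ps u v"
  by (induction qs) (auto simp: min.coboundedI1)

lemma detour_le:
  "(x, y) \<in> set ps \<Longrightarrow> detour d L ps u v \<le> d u x + L x y + d y v \<and> detour d L ps u v \<le> d u y + L x y + d x v"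
  by (induction ps) (auto simp: min.coboundedI1 min.coboundedI2)

lemma greedy_nth:
  "greedy n d L ps \<Longrightarrow> i < length ps \<Longrightarrow>
   \<exists>x y. ps ! i = (x, y) \<and> x < n \<and> y < n \<and>
    (\<forall>u < n. \<forall>v < n. detour d L (drop (Suc i) ps) u v \<le> detour d L (drop (Suc i) ps) x y)"
proof (induction ps arbitrary: i)
  case (Cons p ps)
  then show ?case by (cases p; cases i) auto
qed simp

text \<open>
  The number \<open>b\<close> stands for infinity: it exceeds three times the weight of every path. \<open>D l x y\<close> is the
  least weight of a walk from \<open>x\<close> to \<open>y\<close> that uses at most \<open>l\<close> non-edges.
\<close>

locale distance_tables =
  fixes n k :: nat and E :: "nat set set" and w :: "nat set \<Rightarrow> nat" and b :: nat
    and D P :: "nat \<Rightarrow> nat \<Rightarrow> nat \<Rightarrow> nat" and c Q :: "nat \<Rightarrow> nat \<Rightarrow> nat"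
  assumes E: "E \<subseteq> pairs {0..<n}"
    and b: "3 * (\<Sum>x<n. \<Sum>y<n. weight0 w x y) < b"
    and D0: "apsp n E w b (D 0)"
    and c: "min_plus n (D 0) (weight0 w) c Q"
    and D_Suc: "l < k \<Longrightarrow> min_plus n c (D l) (D (Suc l)) (P l)"
begin

abbreviation "V \<equiv> {0..<n}"
abbreviation "added A \<equiv> A \<inter> non_edges V E"

section \<open>Soundness and optimality of the layered distance tables\<close>

lemma D0_walk: "x < n \<Longrightarrow> y < n \<Longrightarrow> D 0 x y < b \<Longrightarrow> walk V E w x y (D 0 x y)"
  and D0_bound: "x < n \<Longrightarrow> y < n \<Longrightarrow> D 0 x y \<le> b"
  using D0 by (auto simp: apsp_def)

lemma D0_le: "walk V E w x y d \<Longrightarrow> D 0 x y \<le> d"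
  using D0 walk_endpoints[of V E w x y d] by (auto simp: apsp_def)

lemma walk_weight0:
  "x < n \<Longrightarrow> y < n \<Longrightarrow> walk V (E \<union> added {{x, y}}) w x y (weight0 w x y)"
  using walk_edge[of x V y "E \<union> added {{x, y}}" w] walk.Nil[of x V]
  by (auto simp: weight0_def non_edges_def pairs_def)

text \<open>The recorded minimizers are unfolded into a stretch in \<open>E\<close> from
  \<open>x\<close> to \<open>a\<close>, the pair \<open>{a, m}\<close>, and a remainder in the layer
  below. As the total is below \<open>b\<close>, so is every part, and none of them is the
  fictitious infinity.\<close>

lemma D_walk:
  "l \<le> k \<Longrightarrow> x < n \<Longrightarrow> y < n \<Longrightarrow> D l x y < b \<Longrightarrow>
   walk V (E \<union> added (route P Q l x y)) w x y (D l x y)"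
proof (induction l arbitrary: x)
  case 0
  then show ?case using D0_walk by simp
next
  case (Suc l)
  define m where "m = P l x y"
  define a where "a = Q x m"
  have m: "m < n" "D (Suc l) x y = c x m + D l m y"
    using min_plusD[OF D_Suc, of l x y] Suc.prems by (auto simp: m_def)
  have a: "a < n" "c x m = D 0 x a + weight0 w a m"
    using min_plusD[OF c, of x m] m Suc.prems by (auto simp: a_def)
  let ?A = "E \<union> added (route P Q (Suc l) x y)"
  have "walk V ?A w x a (D 0 x a)"
    by (rule walk_mono[OF D0_walk]) (use a m Suc.prems in auto)
  moreover have "walk V ?A w a m (weight0 w a m)"
    by (rule walk_mono[OF walk_weight0]) (use a m in \<open>auto simp: m_def a_def\<close>)
  moreover have "walk V ?A w m y (D l m y)"
    by (rule walk_mono[OF Suc.IH]) (use m Suc.prems in \<open>auto simp: m_def\<close>)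
  ultimately have "walk V ?A w x y (D 0 x a + weight0 w a m + D l m y)"
    by (blast intro: walk_trans)
  then show ?case using a m by simp
qed

text \<open>A walk counted by a layer begins with a stretch of \<open>D 0\<close>, and an edge of
  \<open>E\<close> can be put in front of that stretch without spending a non-edge.\<close>

lemma D_edge:
  assumes "l \<le> k" "{x, z} \<in> E" "y < n"
  shows "D l x y \<le> w {x, z} + D l z y"
proof -
  have xz: "x < n" "z < n" using assms(2) E by (auto simp: pairs_def)
  have 0: "D 0 x v \<le> w {x, z} + D 0 z v" if "v < n" for v
  proof (cases "D 0 z v < b")
    case True
    then show ?thesis using D0_walk[of z v] xz that assms(2) by (intro D0_le walk.Cons) auto
  next
    case False
    \<comment> \<open>The right-hand side is at least \<open>b\<close>, which caps every entry of
      \<open>D 0\<close>.\<close>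
    then show ?thesis using D0_bound[of x v] xz that by simp
  qed
  show ?thesis
  proof (cases l)
    assume "l = 0"
    then show ?thesis using 0[of y] assms(3) \<open>l = 0\<close> by simp
  next
    fix l' assume "l = Suc l'"
    then have mp: "min_plus n c (D l') (D l) (P l')" using D_Suc assms(1) by simp
    define m where "m = P l' z y"
    define a where "a = Q z m"
    have m: "m < n" "D l z y = c z m + D l' m y" "D l x y \<le> c x m + D l' m y"
      using min_plusD[OF mp] xz assms(3) by (auto simp: m_def)
    have a: "a < n" "c z m = D 0 z a + weight0 w a m" "c x m \<le> D 0 x a + weight0 w a m"
      using min_plusD[OF c] xz m(1) by (auto simp: a_def)
    show ?thesis using 0[OF a(1)] a m by simp
  qed
qed

text \<open>The hop starts at \<open>x\<close> itself, after an empty stretch in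
  \<open>E\<close>.\<close>

lemma D_hop:
  assumes "l < k" "x < n" "z < n" "x \<noteq> z" "y < n"
  shows "D (Suc l) x y \<le> w {x, z} + D l z y"
proof -
  have "D (Suc l) x y \<le> c x z + D l z y" using min_plusD(3)[OF D_Suc] assms by simp
  also have "c x z \<le> D 0 x x + weight0 w x z" using min_plusD(3)[OF c] assms by simp
  also have "D 0 x x = 0" using D0_le[OF walk.Nil, of x] assms by simp
  finally show ?thesis using assms by (simp add: weight0_def)
qed

lemma D_mono:
  assumes "l < k" "x < n" "y < n"
  shows "D (Suc l) x y \<le> D l x y"
proof -
  have "D (Suc l) x y \<le> c x x + D l x y" using min_plusD(3)[OF D_Suc] assms by simp
  also have "c x x \<le> D 0 x x + weight0 w x x" using min_plusD(3)[OF c] assms by simp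
  also have "D 0 x x = 0" using D0_le[OF walk.Nil, of x] assms by simp
  finally show ?thesis by (simp add: weight0_def)
qed

lemma D_refl: "l \<le> k \<Longrightarrow> x < n \<Longrightarrow> D l x x = 0"
proof (induction l)
  case 0
  then show ?case using D0_le[OF walk.Nil, of x] by simp
next
  case (Suc l)
  then show ?case using D_mono[of l x x] by simp
qed

text \<open>Every edge of \<open>F\<close> on the path uses up one layer by \<open>D_hop\<close>;
  every other edge stays in its layer by \<open>D_edge\<close>.\<close>

lemma D_le_path_weight:
  assumes "p \<noteq> []" "set p \<subseteq> V" "set (path_edges p) \<subseteq> E \<union> F" "F \<subseteq> pairs V"
    "length (filter (\<lambda>e. e \<in> F) (path_edges p)) \<le> l" "l \<le> k"
  shows "D l (hd p) (last p) \<le> path_weight w p"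
  using assms
proof (induction p arbitrary: l rule: path_edges.induct)
  case (1 u v p)
  let ?y = "last (v # p)"
  have y: "?y < n" using "1.prems"(2) by (metis atLeastLessThan_iff last_in_set list.distinct(1) set_subset_Cons subsetD)
  show ?case
  proof (cases "{u, v} \<in> F")
    case True
    then obtain l' where l': "l = Suc l'" using "1.prems"(5) by (cases l) auto
    have "D l u ?y \<le> w {u, v} + D l' v ?y"
      unfolding l' using True "1.prems"(2,4,6) y l'
      by (intro D_hop) (auto simp: pairs_def card_insert_if split: if_splits)
    also have "D l' v ?y \<le> path_weight w (v # p)"
      using "1.IH"[of l'] "1.prems" True l' by simp
    finally show ?thesis by (simp add: path_weight_def)
  next
    case False
    then have "D l u ?y \<le> w {u, v} + D l v ?y"
      using "1.prems"(3,6) y by (intro D_edge) auto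
    also have "D l v ?y \<le> path_weight w (v # p)"
      using "1.IH"[of l] "1.prems" False by simp
    finally show ?thesis by (simp add: path_weight_def)
  qed
next
  case ("2_2" v)
  then show ?case by (simp add: path_weight_def D_refl)
qed simp

text \<open>A lightest path can be taken simple, so it contains at most \<open>card F\<close> edges
  of \<open>F\<close>, and \<open>k\<close> layers suffice for it.\<close>

lemma D_le_diameter:
  assumes "F \<subseteq> pairs V" "card F \<le> k" "diameter V (E \<union> F) w \<le> enat d" "x < n" "y < n"
  shows "D k x y \<le> d"
proof -
  have finF: "finite F" using assms(1) finite_pairs finite_subset by blast
  obtain e where "e \<le> d" "walk V (E \<union> F) w x y e" using assms(3-5)
    by (metis diameter_le_iff atLeastLessThan_iff zero_le)
  then obtain p where p: "p \<in> paths V (E \<union> F) x y" "path_weight w p \<le> d"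
    using walk_imp_path by (metis order_trans)
  then have "D k (hd p) (last p) \<le> path_weight w p"
    using length_filter_path_edges[OF _ finF, of p] assms(1,2)
    by (intro D_le_path_weight[of p F k]) (auto simp: paths_def)
  then show ?thesis using p by (auto simp: paths_def)
qed

section \<open>Detours and the approximation ratio\<close>

lemma detour_walk:
  assumes "u < n" "v < n" "detour (D 0) (D k) ps u v < b" "\<forall>(x, y) \<in> set ps. x < n \<and> y < n"
  shows "walk V (E \<union> added (routes P Q k ps)) w u v (detour (D 0) (D k) ps u v)"
  using assms(3,4)
proof (induction ps)
  case Nil
  then show ?case using D0_walk[OF assms(1,2)] by (simp add: routes_def)
next
  case (Cons p ps)
  obtain x y where p: "p = (x, y)" by fastforce
  then have xy: "x < n" "y < n" using Cons.prems by auto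
  let ?A = "E \<union> added (routes P Q k (p # ps))"
  have D0A: "walk V ?A w x' y' (D 0 x' y')" if "x' < n" "y' < n" "D 0 x' y' < b" for x' y'
    by (rule walk_mono[OF D0_walk]) (use that in auto)
  have DkA: "walk V ?A w x y (D k x y)" if "D k x y < b"
    by (rule walk_mono[OF D_walk]) (use that xy in \<open>auto simp: routes_def p\<close>)
  let ?d = "detour (D 0) (D k) (p # ps) u v"
  consider "?d = detour (D 0) (D k) ps u v" | "?d = D 0 u x + D k x y + D 0 y v"
    | "?d = D 0 u y + D k x y + D 0 x v"
    unfolding p detour.simps by linarith
  then show ?case
  proof cases
    case 1
    then have "walk V (E \<union> added (routes P Q k ps)) w u v ?d" using Cons by simp
    then show ?thesis by (rule walk_mono) (auto simp: routes_def)
  next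
    case 2
    then have "D 0 u x < b" "D k x y < b" "D 0 y v < b" using Cons.prems(1) by linarith+
    then show ?thesis unfolding 2 using D0A DkA xy assms(1,2) by (intro walk_trans) auto
  next
    case 3
    then have "D 0 u y < b" "D k x y < b" "D 0 x v < b" using Cons.prems(1) by linarith+
    \<comment> \<open>The added route from \<open>x\<close> to \<open>y\<close> is traversed
      backwards here.\<close>
    then show ?thesis unfolding 3
      using walk_trans[OF walk_trans[OF D0A walk_sym[OF DkA]] D0A] xy assms(1,2) by simp
  qed
qed

text \<open>A pigeonhole argument: a pair still too far apart after all rounds, together with the
  \<open>k * k\<close> chosen pairs, would need more types than \<open>endpoint_types\<close>
  allows.\<close>

lemma detour_le_3_diameter:
  assumes gr: "greedy n (D 0) (D k) ps" "length ps = k * k"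
    and F: "F \<subseteq> non_edges V E" "card F \<le> k" "diameter V (E \<union> F) w \<le> enat d"
    and uv: "u < n" "v < n"
  shows "detour (D 0) (D k) ps u v \<le> 3 * d"
proof (rule ccontr)
  let ?H = "detour (D 0) (D k)"
  assume "\<not> ?H ps u v \<le> 3 * d"
  then have far: "3 * d < ?H ps u v" by simp
  have Fp: "F \<subseteq> pairs V" "E \<inter> F = {}" using F by (auto simp: non_edges_def)
  obtain T where T: "finite T" "sym T" "irrefl T" "card T \<le> 2 * k * k"
    and types: "\<And>x y. x \<in> V \<Longrightarrow> y \<in> V \<Longrightarrow> (\<exists>c \<le> d. walk V E w x y c) \<or>
       (\<exists>a b c1 c2. (a, b) \<in> T \<and> walk V E w x a c1 \<and> walk V E w b y c2 \<and> c1 + c2 \<le> d)"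
    by (rule endpoint_types[OF finite_atLeastLessThan Fp F(2,3)]) (rule that)
  \<comment> \<open>The offending pair is placed in front, as if it were chosen last, so that all
    \<open>k * k + 1\<close> pairs satisfy one statement. A smaller index means a later
    choice.\<close>
  define qs where "qs = (u, v) # ps"
  define x where "x i = fst (qs ! i)" for i
  define y where "y i = snd (qs ! i)" for i
  let ?I = "{..<Suc (k * k)}"
  have tail: "x i < n \<and> y i < n \<and> 3 * d < ?H (drop (Suc i) qs) (x i) (y i)" if i: "i \<in> ?I" for i
  proof (cases i)
    case 0
    then show ?thesis using far uv by (simp add: qs_def x_def y_def)
  next
    case (Suc j)
    then obtain x' y' where xy: "ps ! j = (x', y')" "x' < n" "y' < n"
      and mx: "?H (drop (Suc j) ps) u v \<le> ?H (drop (Suc j) ps) x' y'"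
      using greedy_nth[OF gr(1), of j] i gr(2) uv by auto
    \<comment> \<open>Detours only shrink over the rounds, so \<open>(u, v)\<close> was already too
      far apart when the pair at index \<open>j\<close> was chosen, and that pair was at least as
      far apart.\<close>
    have "?H ps u v \<le> ?H (drop (Suc j) ps) u v"
      using detour_antimono[of _ _ "take (Suc j) ps" "drop (Suc j) ps"] by simp
    then show ?thesis using far mx xy Suc by (simp add: qs_def x_def y_def)
  qed
  have D_le_H: "?H ps' x' y' \<le> D 0 x' y'" for ps' x' y'
    using detour_antimono[of "D 0" "D k" ps' "[]" x' y'] by simp
  have "\<exists>t \<in> T. \<exists>c1 c2. walk V E w (x i) (fst t) c1 \<and> walk V E w (snd t) (y i) c2 \<and> c1 + c2 \<le> d"
    if i: "i \<in> ?I" for i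
  proof -
    \<comment> \<open>A walk of weight at most \<open>d\<close> in \<open>E\<close> alone would
      already show in \<open>D 0\<close>; hence every one of these pairs has a type.\<close>
    have False if "c \<le> d" "walk V E w (x i) (y i) c" for c
      using D0_le[OF that(2)] that(1) tail[OF i] D_le_H[of "drop (Suc i) qs" "x i" "y i"] by simp
    then show ?thesis using types[of "x i" "y i"] tail[OF i]
      by (metis atLeastLessThan_iff zero_le fst_conv snd_conv)
  qed
  then obtain \<tau> where \<tau>: "\<And>i. i \<in> ?I \<Longrightarrow> \<tau> i \<in> T \<and> (\<exists>c1 c2. walk V E w (x i) (fst (\<tau> i)) c1 \<and>
      walk V E w (snd (\<tau> i)) (y i) c2 \<and> c1 + c2 \<le> d)"
    by metis
  \<comment> \<open>The pair at index \<open>j\<close> was chosen before the one at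
    \<open>i\<close>, so its route is among the detours for \<open>i\<close>. Going through the
    common endpoints costs at most \<open>a1 + b1\<close> and \<open>a2 + b2\<close> for equal
    types, \<open>a1 + b2\<close> and \<open>a2 + b1\<close> for reversed ones, plus
    \<open>d\<close> for the route: in total at most \<open>3 * d\<close>.\<close>
  have conflict: False if ij: "i < j" "j \<in> ?I" and eq: "\<tau> i = \<tau> j \<or> \<tau> i = prod.swap (\<tau> j)" for i j
  proof -
    have iI: "i \<in> ?I" using ij by simp
    obtain a1 a2 where a: "walk V E w (x i) (fst (\<tau> i)) a1" "walk V E w (snd (\<tau> i)) (y i) a2" "a1 + a2 \<le> d"
      using \<tau>[OF iI] by blast
    obtain b1 b2 where b: "walk V E w (x j) (fst (\<tau> j)) b1" "walk V E w (snd (\<tau> j)) (y j) b2" "b1 + b2 \<le> d"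
      using \<tau>[OF ij(2)] by blast
    have L: "D k (x j) (y j) \<le> d" using D_le_diameter[OF Fp(1) F(2,3)] tail[OF ij(2)] by simp
    have "drop (Suc i) qs ! (j - Suc i) = (x j, y j)" "j - Suc i < length (drop (Suc i) qs)"
      using ij gr(2) by (simp_all add: x_def y_def qs_def)
    then have "(x j, y j) \<in> set (drop (Suc i) qs)" by (metis nth_mem)
    note H = detour_le[OF this, of "D 0" "D k" "x i" "y i"]
    have "?H (drop (Suc i) qs) (x i) (y i) \<le> 3 * d"
      using eq
    proof
      assume eq: "\<tau> i = \<tau> j"
      have "D 0 (x i) (x j) \<le> a1 + b1" "D 0 (y j) (y i) \<le> b2 + a2"
        using D0_le[OF walk_trans[OF a(1) walk_sym[OF b(1)[folded eq]]]]
          D0_le[OF walk_trans[OF walk_sym[OF b(2)[folded eq]] a(2)]] by auto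
      then show ?thesis using H L a(3) b(3) by linarith
    next
      assume eq: "\<tau> i = prod.swap (\<tau> j)"
      have "D 0 (x i) (y j) \<le> a1 + b2" "D 0 (x j) (y i) \<le> b1 + a2"
        using D0_le[OF walk_trans[OF a(1)[unfolded eq fst_swap] b(2)]]
          D0_le[OF walk_trans[OF b(1) a(2)[unfolded eq snd_swap]]] by auto
      then show ?thesis using H L a(3) b(3) by linarith
    qed
    then show False using tail[OF iI] by simp
  qed
  \<comment> \<open>Every pair contributes its type in both orientations, which differ as
    \<open>T\<close> is irreflexive. This gives \<open>2 * (k * k + 1)\<close> elements in a set of
    at most \<open>2 * k * k\<close>.\<close>
  define f where "f = (\<lambda>(i, r). if r then \<tau> i else prod.swap (\<tau> i))"
  have "inj_on f (?I \<times> UNIV)"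
  proof (rule inj_onI)
    fix p q assume pq: "p \<in> ?I \<times> UNIV" "q \<in> ?I \<times> UNIV" "f p = f q"
    obtain i r where p: "p = (i, r)" by fastforce
    obtain j s where q: "q = (j, s)" by fastforce
    from pq have ij: "i \<in> ?I" "j \<in> ?I" and eq: "f (i, r) = f (j, s)" by (auto simp: p q)
    then have eq': "\<tau> i = \<tau> j \<or> \<tau> i = prod.swap (\<tau> j)"
      by (auto simp: f_def prod_eq_iff split: if_splits)
    then have "i = j"
      using conflict[of i j] conflict[of j i] ij by (metis linorder_neqE_nat swap_swap)
    moreover have "\<tau> i \<noteq> prod.swap (\<tau> i)"
      using \<tau>[of i] ij \<open>irrefl T\<close> by (cases "\<tau> i") (auto simp: irrefl_def)
    ultimately show "p = q" using eq by (auto simp: f_def p q split: if_splits)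
  qed
  moreover have "f ` (?I \<times> UNIV) \<subseteq> T"
    using \<tau> \<open>sym T\<close> by (auto simp: f_def sym_def prod.swap_def)
  ultimately have "card (?I \<times> (UNIV :: bool set)) \<le> card T" using T(1) by (rule card_inj_on_le)
  then show False using T(4) by (simp add: card_cartesian_product)
qed

text \<open>The cost bound comes from \<open>k * k\<close> routes of at most \<open>k\<close> pairs
  each. The ratio is shown against each feasible set separately, which suffices because the optimum
  is attained.\<close>

theorem approx_solution_greedy:
  assumes gr: "greedy n (D 0) (D k) ps" "length ps = k * k"
  shows "approx_solution ((k + 1)\<^sup>2) 3 V E w (\<lambda>_. 1) k (added (routes P Q k ps))"
proof -
  let ?F = "added (routes P Q k ps)"
  have "card ?F \<le> card (routes P Q k ps)" using card_routes by (intro card_mono) auto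
  also have "\<dots> \<le> k * k * k" using card_routes[of P Q k ps] gr by simp
  also have "\<dots> \<le> (k + 1)\<^sup>2 * k"
    unfolding power2_eq_square by (intro mult_le_mono) auto
  finally have cardF: "card ?F \<le> (k + 1)\<^sup>2 * k" .
  have "diameter V (E \<union> ?F) w \<le> 3 * diameter V (E \<union> F) w"
    if F: "F \<in> feasible V E (\<lambda>_. 1) k" for F
  proof (cases "diameter V (E \<union> F) w")
    case infinity
    then show ?thesis by (simp add: numeral_eq_enat)
  next
    case (enat d)
    have F: "F \<subseteq> non_edges V E" "card F \<le> k" using F by (auto simp: feasible_def)
    let ?S = "\<Sum>x<n. \<Sum>y<n. weight0 w x y"
    \<comment> \<open>A finite diameter is realized by simple paths and hence bounded by the total
      weight. This puts \<open>3 * d\<close> below \<open>b\<close>, so that the detour values in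
      question belong to actual walks.\<close>
    have "diameter V (E \<union> F) w \<le> enat ?S"
      unfolding diameter_le_iff
    proof (intro ballI)
      fix u v assume "u \<in> V" "v \<in> V"
      then obtain c' where "walk V (E \<union> F) w u v c'"
        using enat diameter_le_iff[of V "E \<union> F" w d] by (metis order.refl)
      then obtain p where p: "p \<in> paths V (E \<union> F) u v" by (metis walk_imp_path)
      moreover have "E \<union> F \<subseteq> pairs V" using E F by (auto simp: non_edges_def)
      ultimately have "path_weight w p \<le> ?S"
        by (intro path_weight_le_sum) (auto simp: paths_def)
      then show "\<exists>c' \<le> ?S. walk V (E \<union> F) w u v c'"
        using p path_imp_walk[of p V "E \<union> F" w] by (auto simp: paths_def)
    qed
    then have "3 * d < b" using enat b by simp
    have "\<forall>(x, y) \<in> set ps. x < n \<and> y < n"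
      using greedy_nth[OF gr(1)] by (fastforce simp: in_set_conv_nth)
    then have "\<exists>c' \<le> 3 * d. walk V (E \<union> ?F) w u v c'" if "u < n" "v < n" for u v
      using detour_walk[OF that, of ps] detour_le_3_diameter[OF gr F, of d u v] that enat \<open>3 * d < b\<close>
      by (metis order.refl order.strict_trans1)
    then have "diameter V (E \<union> ?F) w \<le> enat (3 * d)" by (simp add: diameter_le_iff)
    then show ?thesis using enat by (simp add: numeral_eq_enat)
  qed
  moreover have "\<exists>F \<in> feasible V E (\<lambda>_. 1) k. D_opt V E w (\<lambda>_. 1) k = diameter V (E \<union> F) w"
  proof -
    have "{} \<in> feasible V E (\<lambda>_. 1) k" by (simp add: feasible_def)
    then have "D_opt V E w (\<lambda>_. 1) k \<in> (\<lambda>F. diameter V (E \<union> F) w) ` feasible V E (\<lambda>_. 1) k"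
      unfolding D_opt_def by (intro wellorder_InfI) blast
    then show ?thesis by blast
  qed
  ultimately show ?thesis using cardF
    by (auto simp: approx_solution_def numeral_eq_enat)
qed

end

section \<open>Budget zero and budgets of at least \<open>n\<close>\<close>

lemma diameter_mono: "A \<subseteq> B \<Longrightarrow> diameter V B w \<le> diameter V A w"
  unfolding diameter_def distance_def
  by (intro SUP_mono' INF_superset_mono) (auto simp: paths_def)

lemma le_3_D_opt:
  assumes "\<And>F. F \<in> feasible V E c B \<Longrightarrow> d \<le> diameter V (E \<union> F) w"
  shows "d \<le> enat 3 * D_opt V E w c B"
proof -
  have "d \<le> D_opt V E w c B" unfolding D_opt_def using assms by (rule INF_greatest)
  also have "\<dots> = 1 * D_opt V E w c B" by simp
  also have "\<dots> \<le> enat 3 * D_opt V E w c B" by (rule mult_right_mono) (simp_all add: one_enat_def)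
  finally show ?thesis .
qed

lemma approx_solution_empty:
  assumes "finite V"
  shows "approx_solution \<alpha> 3 V E w (\<lambda>_. 1) 0 {}"
  unfolding approx_solution_def
proof (intro conjI le_3_D_opt)
  fix F assume F: "F \<in> feasible V E (\<lambda>_. 1) 0"
  \<comment> \<open>A sum over an infinite set is 0 by default; finiteness lets cost zero force
    \<open>F = {}\<close>.\<close>
  then have "finite F" using assms finite_pairs finite_subset
    by (metis (no_types, lifting) Diff_subset feasible_def mem_Collect_eq non_edges_def)
  then have "F = {}" using F by (simp add: feasible_def)
  then show "diameter V (E \<union> {}) w \<le> diameter V (E \<union> F) w" by simp
qed simp_all

lemma card_pairs_le: "card (pairs {0..<n}) \<le> n * (n :: nat)"
proof -
  have "pairs {0..<n} \<subseteq> (\<lambda>(x, y). {x, y}) ` ({0..<n} \<times> {0..<n})" by (auto elim!: pairsE)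
  then have "card (pairs {0..<n}) \<le> card ({0..<n} \<times> {0..<n})" by (intro surj_card_le) auto
  then show ?thesis by (simp add: card_cartesian_product)
qed

lemma approx_solution_all:
  assumes "n \<le> k"
  shows "approx_solution ((k + 1)\<^sup>2) 3 {0..<n} E w (\<lambda>_. 1) k (non_edges {0..<n} E)"
  unfolding approx_solution_def
proof (intro conjI le_3_D_opt)
  have "card (non_edges {0..<n} E) \<le> card (pairs {0..<n})"
    unfolding non_edges_def by (intro card_mono finite_pairs) auto
  also have "\<dots> \<le> k * k" using card_pairs_le[of n] mult_le_mono[OF assms assms] by linarith
  also have "\<dots> \<le> (k + 1)\<^sup>2 * k"
    unfolding power2_eq_square by (intro mult_le_mono) simp_all
  finally show "(\<Sum>_\<in>non_edges {0..<n} E. 1) \<le> (k + 1)\<^sup>2 * k" by simp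
qed (auto simp: feasible_def intro: diameter_mono)

section \<open>Total correctness with time bounds\<close>

text \<open>Total correctness with a time bound. As \<open>exec\<close> is deterministic, the run
  that exists is the only one.\<close>

definition runs :: "com \<Rightarrow> state \<Rightarrow> nat \<Rightarrow> (state \<Rightarrow> bool) \<Rightarrow> bool" where
  "runs p s T Q \<longleftrightarrow> (\<exists>t s'. exec p s t s' \<and> t \<le> T \<and> Q s')"

lemma runsI: "exec p s t s' \<Longrightarrow> t \<le> T \<Longrightarrow> Q s' \<Longrightarrow> runs p s T Q"
  unfolding runs_def by blast

lemma runs_weaken: "runs p s T Q \<Longrightarrow> T \<le> T' \<Longrightarrow> (\<And>s'. Q s' \<Longrightarrow> Q' s') \<Longrightarrow> runs p s T' Q'"
  unfolding runs_def by (meson order_trans)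

lemma runs_Skip: "Q s \<Longrightarrow> runs Skip s 1 Q"
  unfolding runs_def using exec.Skip by blast

lemma runs_Seq:
  "runs p s T R \<Longrightarrow> (\<And>s'. R s' \<Longrightarrow> runs q s' T' Q) \<Longrightarrow> runs (Seq p q) s (T + T') Q"
  unfolding runs_def by (meson exec.Seq add_mono)

lemma runs_If:
  "(bval b s \<Longrightarrow> runs p s T Q) \<Longrightarrow> (\<not> bval b s \<Longrightarrow> runs q s T Q) \<Longrightarrow> runs (If b p q) s (bcost b + 1 + T) Q"
  unfolding runs_def by (cases "bval b s") (meson exec.IfTrue exec.IfFalse add_left_mono)+

section \<open>Symbolic execution of loop-free code\<close>

fun loop_free :: "com \<Rightarrow> bool" where
  "loop_free (Seq p q) \<longleftrightarrow> loop_free p \<and> loop_free q"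
| "loop_free (If b p q) \<longleftrightarrow> loop_free p \<and> loop_free q"
| "loop_free (While b p) \<longleftrightarrow> False"
| "loop_free p \<longleftrightarrow> True"

text \<open>The last clause is meant for \<open>Skip\<close>; on \<open>While\<close> it is a dummy
  value, which \<open>loop_free\<close> excludes.\<close>

fun result :: "com \<Rightarrow> state \<Rightarrow> state" where
  "result (Write x i a) s = s(x := (s x)(aval i s := aval a s))"
| "result (Seq p q) s = result q (result p s)"
| "result (If b p q) s = (if bval b s then result p s else result q s)"
| "result p s = s"

fun time_bound :: "com \<Rightarrow> nat" where
  "time_bound (Write x i a) = acost i + acost a + 1"
| "time_bound (Seq p q) = time_bound p + time_bound q"
| "time_bound (If b p q) = bcost b + 1 + max (time_bound p) (time_bound q)"
| "time_bound p = 1"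

lemma runs_loop_free: "loop_free p \<Longrightarrow> Q (result p s) \<Longrightarrow> runs p s (time_bound p) Q"
proof (induction p arbitrary: s Q)
  case (Write x i a)
  then show ?case by (auto intro!: runsI[OF exec.Write] simp del: fun_upd_apply)
next
  case (Seq p q)
  have "runs p s (time_bound p) (\<lambda>s'. s' = result p s)" using Seq by simp
  then show ?case unfolding time_bound.simps by (rule runs_Seq) (use Seq in simp)
next
  case (If b p q)
  show ?case unfolding time_bound.simps
  proof (rule runs_If)
    assume "bval b s"
    then have "runs p s (time_bound p) Q" using If by simp
    then show "runs p s (max (time_bound p) (time_bound q)) Q" by (rule runs_weaken) auto
  next
    assume "\<not> bval b s"
    then have "runs q s (time_bound q) Q" using If by simp
    then show "runs q s (max (time_bound p) (time_bound q)) Q" by (rule runs_weaken) auto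
  qed
qed (auto intro: runs_Skip[simplified])

lemma runs_body:
  "loop_free p \<Longrightarrow> time_bound p \<le> T \<Longrightarrow> Q (result p s) \<Longrightarrow> runs p s T Q"
  by (rule runs_weaken[OF runs_loop_free[where Q = Q]])

section \<open>Counting loops\<close>

abbreviation "var x \<equiv> Read x (N 0)"
abbreviation "assign x a \<equiv> Write x (N 0) a"

definition For :: "vname \<Rightarrow> vname \<Rightarrow> com \<Rightarrow> com" where
  "For x v p = Seq (assign x (N 0)) (While (Less (var x) (var v)) (Seq p (assign x (Plus (var x) (N 1)))))"

text \<open>An iteration pays 6 steps for the test and 6 for the increment; the constant 9 is the
  initialization (3) and the final failing test (6).\<close>

definition for_time :: "nat \<Rightarrow> nat \<Rightarrow> nat" where
  "for_time m T = m * (T + 12) + 9"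

lemma runs_For:
  assumes bound: "\<And>t s. I t s \<Longrightarrow> s v 0 = m"
    and body: "\<And>t s. t < m \<Longrightarrow> I t s \<Longrightarrow> s x 0 = t \<Longrightarrow>
      runs p s T (\<lambda>s'. s' x 0 = t \<and> I (Suc t) (s'(x := (s' x)(0 := Suc t))))"
    and init: "I 0 (s(x := (s x)(0 := 0)))"
  shows "runs (For x v p) s (for_time m T) (I m)"
proof -
  let ?incr = "assign x (Plus (var x) (N 1))"
  let ?loop = "While (Less (var x) (var v)) (Seq p ?incr)"
  have loop: "runs ?loop s ((m - t) * (T + 12) + 6) (I m)" if "I t s" "s x 0 = t" "t \<le> m" for t s
    using that
  proof (induction "m - t" arbitrary: t s)
    case 0
    then have "\<not> bval (Less (var x) (var v)) s" using bound[of t s] by simp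
    then have "exec ?loop s (bcost (Less (var x) (var v)) + 1) s" by (rule exec.WhileFalse)
    then show ?case by (rule runsI) (use 0 in auto)
  next
    case (Suc d)
    have "t < m" using Suc.hyps(2) by simp
    then obtain t1 s1 where 1: "exec p s t1 s1" "t1 \<le> T" "s1 x 0 = t" "I (Suc t) (s1(x := (s1 x)(0 := Suc t)))"
      using body[OF _ Suc.prems(1,2)] unfolding runs_def by blast
    let ?s2 = "s1(x := (s1 x)(0 := Suc t))"
    have "exec ?incr s1 6 ?s2" using exec.Write[of x "N 0" "Plus (var x) (N 1)" s1] 1(3)
      by (simp add: eval_nat_numeral)
    then have 2: "exec (Seq p ?incr) s (t1 + 6) ?s2" using 1(1) by (rule exec.Seq[rotated])
    have "runs ?loop ?s2 ((m - Suc t) * (T + 12) + 6) (I m)"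
      by (rule Suc.hyps(1)) (use Suc 1 in auto)
    then obtain t3 s3 where 3: "exec ?loop ?s2 t3 s3" "t3 \<le> (m - Suc t) * (T + 12) + 6" "I m s3"
      by (auto simp: runs_def)
    have "bval (Less (var x) (var v)) s" using bound[of t s] Suc by simp
    from exec.WhileTrue[OF this 2 3(1)]
    have e: "exec ?loop s (6 + (t1 + 6) + t3) s3" by simp
    have "m - t = Suc (m - Suc t)" using Suc by simp
    then have "6 + (t1 + 6) + t3 \<le> (m - t) * (T + 12) + 6" using 1(2) 3(2) by simp
    then show ?case using e 3(3) unfolding runs_def by blast
  qed
  have "runs (assign x (N 0)) s 3 (\<lambda>s'. s' = s(x := (s x)(0 := 0)))"
    by (rule runs_body) simp_all
  then have "runs (For x v p) s (3 + (m * (T + 12) + 6)) (I m)"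
    unfolding For_def by (rule runs_Seq) (use loop[of 0] init in auto)
  then show ?thesis by (simp add: for_time_def add.commute)
qed

text \<open>
  The cells of an \<open>n \<times> n\<close> matrix are visited in row-major order, which allows invariants of \<open>For2\<close> to be
  indexed by the number of visited cells.
\<close>

definition For2 :: "com \<Rightarrow> com" where
  "For2 p = For ''i'' ''n'' (For ''j'' ''n'' p)"

definition for2_time :: "nat \<Rightarrow> nat \<Rightarrow> nat" where
  "for2_time n T = for_time n (for_time n T)"

lemma runs_For2:
  assumes bound: "\<And>t s. I t s \<Longrightarrow> s ''n'' 0 = n"
    and indep: "\<And>t s f. I t (s(''i'' := f)) = I t s" "\<And>t s f. I t (s(''j'' := f)) = I t s"
    and body: "\<And>i j s. i < n \<Longrightarrow> j < n \<Longrightarrow> I (i * n + j) s \<Longrightarrow> s ''i'' 0 = i \<Longrightarrow> s ''j'' 0 = j \<Longrightarrow>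
      runs p s T (\<lambda>s'. s' ''i'' 0 = i \<and> s' ''j'' 0 = j \<and> I (Suc (i * n + j)) s')"
    and init: "I 0 s"
  shows "runs (For2 p) s (for2_time n T) (I (n * n))"
  unfolding For2_def for2_time_def
proof (rule runs_For[where I = "\<lambda>i. I (i * n)"])
  fix i s assume i: "i < n" "I (i * n) s" "s ''i'' 0 = i"
  have "runs (For ''j'' ''n'' p) s (for_time n T) (\<lambda>s'. s' ''i'' 0 = i \<and> I (i * n + n) s')"
  proof (rule runs_For[where I = "\<lambda>j s'. s' ''i'' 0 = i \<and> I (i * n + j) s'"])
    fix j s assume "j < n" "s ''i'' 0 = i \<and> I (i * n + j) s" "s ''j'' 0 = j"
    then show "runs p s T (\<lambda>s'. s' ''j'' 0 = j \<and> (s'(''j'' := (s' ''j'')(0 := Suc j))) ''i'' 0 = i \<and>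
        I (i * n + Suc j) (s'(''j'' := (s' ''j'')(0 := Suc j))))"
      using i by (intro runs_weaken[OF body]) (auto simp: indep)
  qed (use i bound in \<open>auto simp: indep\<close>)
  then show "runs (For ''j'' ''n'' p) s (for_time n T)
      (\<lambda>s'. s' ''i'' 0 = i \<and> I (Suc i * n) (s'(''i'' := (s' ''i'')(0 := Suc i))))"
    by (rule runs_weaken) (auto simp: indep add.commute)
qed (use bound init in \<open>auto simp: indep\<close>)

section \<open>Frame conditions and addressing of matrix cells\<close>

definition same :: "vname set \<Rightarrow> state \<Rightarrow> state \<Rightarrow> bool" where
  "same X s s' \<longleftrightarrow> (\<forall>y. y \<notin> X \<longrightarrow> s' y = s y)"

lemma same_refl: "same X s s" by (simp add: same_def)

lemma sameD: "same X s s' \<Longrightarrow> y \<notin> X \<Longrightarrow> s' y = s y" by (simp add: same_def)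

lemma same_upd: "y \<in> X \<Longrightarrow> same X s (s'(y := f)) = same X s s'"
  by (auto simp: same_def)

lemma same_trans: "same X s s' \<Longrightarrow> same Y s' s'' \<Longrightarrow> X \<subseteq> Z \<Longrightarrow> Y \<subseteq> Z \<Longrightarrow> same Z s s''"
  unfolding same_def by (metis subsetD)

text \<open>The machine has no multiplication, so the row offsets \<open>i * n\<close> are tabulated
  once in \<open>R\<close>; its entry at \<open>n\<close> supplies \<open>n * n\<close>.\<close>

definition sized :: "nat \<Rightarrow> nat \<Rightarrow> state \<Rightarrow> bool" where
  "sized n k s \<longleftrightarrow> s ''n'' 0 = n \<and> s ''k'' 0 = k \<and> s ''nn'' 0 = n * n \<and> (\<forall>i \<le> n. s ''R'' i = i * n)"

lemma sized_same: "same X s s' \<Longrightarrow> X \<inter> {''n'', ''k'', ''nn'', ''R''} = {} \<Longrightarrow> sized n k s' = sized n k s"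
  by (auto simp: sized_def same_def)

lemma index_less: "x < n \<Longrightarrow> y < n \<Longrightarrow> x * n + y < n * (n :: nat)"
proof -
  assume "x < n" "y < n"
  then have "x * n + y < Suc x * n" by simp
  also have "\<dots> \<le> n * n" using \<open>x < n\<close> by (intro mult_le_mono1) simp
  finally show ?thesis .
qed

abbreviation "idx x y \<equiv> Plus (Read ''R'' (var x)) (var y)"
abbreviation "Eq a b \<equiv> And (Not (Less a b)) (Not (Less b a))"

definition "comp_rows = Seq
  (For ''m'' ''n'' (Write ''R'' (Plus (var ''m'') (N 1)) (Plus (Read ''R'' (var ''m'')) (var ''n''))))
  (assign ''nn'' (Read ''R'' (var ''n'')))"

lemma runs_comp_rows:
  assumes "s ''n'' 0 = n" "s ''k'' 0 = k" "s ''R'' 0 = 0"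
  shows "runs comp_rows s (for_time n 11 + 5) (\<lambda>s'. same {''m'', ''R'', ''nn''} s s' \<and> sized n k s')"
proof -
  have "runs comp_rows s (for_time n 11 + time_bound (assign ''nn'' (Read ''R'' (var ''n''))))
    (\<lambda>s'. same {''m'', ''R'', ''nn''} s s' \<and> sized n k s')"
    unfolding comp_rows_def
  proof (rule runs_Seq[OF runs_For[where I = "\<lambda>t s'. same {''m'', ''R'', ''nn''} s s' \<and> (\<forall>i \<le> t. s' ''R'' i = i * n)"]])
    fix t s' assume *: "t < n" "same {''m'', ''R'', ''nn''} s s' \<and> (\<forall>i \<le> t. s' ''R'' i = i * n)" "s' ''m'' 0 = t"
    then have "s' ''n'' 0 = n" using assms sameD[of "{''m'', ''R'', ''nn''}" s s' "''n''"] by simp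
    then show "runs (Write ''R'' (Plus (var ''m'') (N 1)) (Plus (Read ''R'' (var ''m'')) (var ''n''))) s' 11
        (\<lambda>s'. s' ''m'' 0 = t \<and> same {''m'', ''R'', ''nn''} s (s'(''m'' := (s' ''m'')(0 := Suc t))) \<and>
          (\<forall>i \<le> Suc t. (s'(''m'' := (s' ''m'')(0 := Suc t))) ''R'' i = i * n))"
      using * by (intro runs_weaken[OF runs_loop_free]) (auto simp: same_upd le_Suc_eq)
  next
    fix s' assume *: "same {''m'', ''R'', ''nn''} s s' \<and> (\<forall>i \<le> n. s' ''R'' i = i * n)"
    then show "runs (assign ''nn'' (Read ''R'' (var ''n''))) s'
         (time_bound (assign ''nn'' (Read ''R'' (var ''n''))))
         (\<lambda>s'. same {''m'', ''R'', ''nn''} s s' \<and> sized n k s')"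
      using assms sameD[of "{''m'', ''R'', ''nn''}" s s' "''n''"] sameD[of "{''m'', ''R'', ''nn''}" s s' "''k''"]
      by (intro runs_loop_free) (auto simp: same_upd sized_def)
  qed (use assms in \<open>auto simp: same_upd same_refl sameD\<close>)
  then show ?thesis by (simp add: eval_nat_numeral)
qed

lemma sizedD:
  assumes "sized n k s"
  shows "s ''n'' 0 = n" "s ''k'' 0 = k" "s ''nn'' 0 = n * n" "i \<le> n \<Longrightarrow> s ''R'' i = i * n"
  using assms by (auto simp: sized_def)

lemma index_eq_iff:
  fixes x y i j :: nat
  assumes "y < n" "j < n"
  shows "x * n + y = i * n + j \<longleftrightarrow> x = i \<and> y = j"
proof
  assume eq: "x * n + y = i * n + j"
  have "x = (x * n + y) div n" using assms by simp
  also have "\<dots> = i" unfolding eq using assms by simp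
  finally show "x = i \<and> y = j" using eq by simp
qed simp

lemma index_less_Suc:
  assumes "y < n" "j < n"
  shows "x * n + y < Suc (i * n + j) \<longleftrightarrow> x * n + y < i * n + j \<or> x = i \<and> y = j"
  using index_eq_iff[OF assms, of x i] by linarith

text \<open>The body is analysed on a partially overwritten array \<open>A\<close>, in which visited
  cells hold \<open>f\<close> and the others their old values. This covers updates in place as
  well.\<close>

lemma runs_fill:
  assumes sz: "sized n k s" and A: "A \<notin> {''n'', ''k'', ''nn'', ''R'', ''i'', ''j''}"
    and p: "loop_free p" "time_bound p \<le> T"
    and body: "\<And>i j s'. i < n \<Longrightarrow> j < n \<Longrightarrow> same {''i'', ''j'', A} s s' \<Longrightarrow> s' ''i'' 0 = i \<Longrightarrow> s' ''j'' 0 = j \<Longrightarrow>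
      (\<And>x y. x < n \<Longrightarrow> y < n \<Longrightarrow>
        s' A (x * n + y) = (if x * n + y < i * n + j then f x y else s A (x * n + y))) \<Longrightarrow>
      result p s' = s'(A := (s' A)(i * n + j := f i j))"
  shows "runs (For2 p) s (for2_time n T)
    (\<lambda>s'. same {''i'', ''j'', A} s s' \<and> (\<forall>x < n. \<forall>y < n. s' A (x * n + y) = f x y))"
proof -
  have sz': "sized n k s'" if "same {''i'', ''j'', A} s s'" for s'
    using sized_same[OF that] A sz by auto
  let ?I = "\<lambda>t s'. same {''i'', ''j'', A} s s' \<and>
      (\<forall>x < n. \<forall>y < n. s' A (x * n + y) = (if x * n + y < t then f x y else s A (x * n + y)))"
  have "runs (For2 p) s (for2_time n T) (?I (n * n))"
  proof (rule runs_For2[where I = ?I])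
    fix t s' assume "?I t s'"
    then show "s' ''n'' 0 = n" using sizedD(1)[OF sz'] by blast
  next
    fix i j s' assume ij: "i < n" "j < n" and I: "?I (i * n + j) s'" and *: "s' ''i'' 0 = i" "s' ''j'' 0 = j"
    have "result p s' = s'(A := (s' A)(i * n + j := f i j))"
      by (rule body) (use ij I * in auto)
    then show "runs p s' T (\<lambda>s'. s' ''i'' 0 = i \<and> s' ''j'' 0 = j \<and> ?I (Suc (i * n + j)) s')"
      using I * A ij p
      by (intro runs_body) (auto simp: same_upd index_less_Suc index_eq_iff)
  qed (use A in \<open>auto simp: same_upd same_refl\<close>)
  then show ?thesis by (rule runs_weaken) (auto simp: index_less)
qed

section \<open>The distance tables\<close>

text \<open>Adding every cell three times stands in for a multiplication by 3; starting from 1 makes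
  the bound strict.\<close>

definition "comp_infinity = Seq (assign ''b'' (N 1)) (For2 (assign ''b'' (Plus (var ''b'')
  (Plus (Read ''w'' (idx ''i'' ''j'')) (Plus (Read ''w'' (idx ''i'' ''j'')) (Read ''w'' (idx ''i'' ''j'')))))))"

lemma runs_comp_infinity:
  assumes sz: "sized n k s"
  shows "runs comp_infinity s (3 + for2_time n 30)
    (\<lambda>s'. same {''i'', ''j'', ''b''} s s' \<and> s' ''b'' 0 = 1 + 3 * (\<Sum>q < n * n. s ''w'' q))"
  unfolding comp_infinity_def
proof (rule runs_Seq)
  let ?s = "s(''b'' := (s ''b'')(0 := 1))"
  show "runs (assign ''b'' (N 1)) s 3 (\<lambda>s'. s' = ?s)" by (rule runs_body) simp_all
  fix s1 assume s1: "s1 = ?s"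
  let ?I = "\<lambda>t s'. same {''i'', ''j'', ''b''} s s' \<and> s' ''b'' 0 = 1 + 3 * (\<Sum>q < t. s ''w'' q)"
  show "runs (For2 (assign ''b'' (Plus (var ''b'')
    (Plus (Read ''w'' (idx ''i'' ''j'')) (Plus (Read ''w'' (idx ''i'' ''j'')) (Read ''w'' (idx ''i'' ''j''))))))) s1
    (for2_time n 30) (?I (n * n))"
  proof (rule runs_For2[where I = ?I])
    fix t s' assume "?I t s'"
    then have "same {''i'', ''j'', ''b''} s s'" by blast
    from sameD[OF this, of "''n''"] show "s' ''n'' 0 = n" using sizedD[OF sz] by simp
  next
    fix i j s' assume ij: "i < n" "j < n" and I: "?I (i * n + j) s'" and *: "s' ''i'' 0 = i" "s' ''j'' 0 = j"
    then have same: "same {''i'', ''j'', ''b''} s s'" by blast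
    have "s' ''R'' i = i * n" "s' ''w'' = s ''w''"
      using sameD[OF same, of "''R''"] sameD[OF same, of "''w''"] sizedD(4)[OF sz, of i] ij by simp_all
    then show "runs (assign ''b'' (Plus (var ''b'') (Plus (Read ''w'' (idx ''i'' ''j''))
       (Plus (Read ''w'' (idx ''i'' ''j'')) (Read ''w'' (idx ''i'' ''j'')))))) s' 30
       (\<lambda>s'. s' ''i'' 0 = i \<and> s' ''j'' 0 = j \<and> ?I (Suc (i * n + j)) s')"
      using I * by (intro runs_body) (auto simp: same_upd)
  qed (auto simp: same_upd same_refl s1)
qed

definition "comp_init = For2 (If (Eq (var ''i'') (var ''j'')) (Write ''D'' (idx ''i'' ''j'') (N 0))
  (If (Less (N 0) (Read ''E'' (idx ''i'' ''j''))) (Write ''D'' (idx ''i'' ''j'') (Read ''w'' (idx ''i'' ''j'')))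
    (Write ''D'' (idx ''i'' ''j'') (var ''b''))))"

lemma runs_comp_init:
  assumes sz: "sized n k s"
  shows "runs comp_init s (for2_time n 50) (\<lambda>s'. same {''i'', ''j'', ''D''} s s' \<and>
    (\<forall>x < n. \<forall>y < n. s' ''D'' (x * n + y) =
      (if x = y then 0 else if 0 < s ''E'' (x * n + y) then s ''w'' (x * n + y) else s ''b'' 0)))"
  unfolding comp_init_def
proof (rule runs_fill[OF sz])
  fix i j s' assume ij: "i < n" "j < n" and I: "same {''i'', ''j'', ''D''} s s'"
    and *: "s' ''i'' 0 = i" "s' ''j'' 0 = j"
  have "s' ''R'' i = i * n" "s' ''w'' = s ''w''" "s' ''E'' = s ''E''" "s' ''b'' = s ''b''"
    using sameD[OF I, of "''R''"] sameD[OF I, of "''w''"] sameD[OF I, of "''E''"]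
      sameD[OF I, of "''b''"] sizedD(4)[OF sz, of i] ij by simp_all
  then show "result (If (Eq (var ''i'') (var ''j'')) (Write ''D'' (idx ''i'' ''j'') (N 0))
  (If (Less (N 0) (Read ''E'' (idx ''i'' ''j''))) (Write ''D'' (idx ''i'' ''j'') (Read ''w'' (idx ''i'' ''j'')))
    (Write ''D'' (idx ''i'' ''j'') (var ''b'')))) s' = s'(''D'' := (s' ''D'')(i * n + j :=
      if i = j then 0 else if 0 < s ''E'' (i * n + j) then s ''w'' (i * n + j) else s ''b'' 0))"
    using * by auto
qed auto

definition "relax_body = If (Less (Plus (Read ''D'' (idx ''i'' ''m'')) (Read ''D'' (idx ''m'' ''j''))) (Read ''D'' (idx ''i'' ''j'')))
  (Write ''D'' (idx ''i'' ''j'') (Plus (Read ''D'' (idx ''i'' ''m'')) (Read ''D'' (idx ''m'' ''j'')))) Skip"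

definition "comp_floyd = For ''m'' ''n'' (For2 relax_body)"

lemma runs_relax:
  assumes sz: "sized n k s" and m: "m < n" "s ''m'' 0 = m"
    and d: "\<And>x y. x < n \<Longrightarrow> y < n \<Longrightarrow> s ''D'' (x * n + y) = floyd d m x y"
  shows "runs (For2 relax_body) s (for2_time n 50) (\<lambda>s'. same {''i'', ''j'', ''D''} s s' \<and>
    (\<forall>x < n. \<forall>y < n. s' ''D'' (x * n + y) = floyd d (Suc m) x y))"
proof (rule runs_fill[OF sz])
  fix i j s' assume ij: "i < n" "j < n" and I: "same {''i'', ''j'', ''D''} s s'"
    and *: "s' ''i'' 0 = i" "s' ''j'' 0 = j" and
    D: "\<And>x y. x < n \<Longrightarrow> y < n \<Longrightarrow>
       s' ''D'' (x * n + y) = (if x * n + y < i * n + j then floyd d (Suc m) x y else s ''D'' (x * n + y))"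
  have 1: "s' ''R'' i = i * n" "s' ''R'' m = m * n" "s' ''m'' 0 = m"
    using sameD[OF I, of "''R''"] sameD[OF I, of "''m''"] sizedD(4)[OF sz, of i] sizedD(4)[OF sz, of m] ij m
    by simp_all
  \<comment> \<open>Updating in place is harmless: row and column \<open>m\<close> keep their values
    in round \<open>m\<close>, since \<open>min v (v + u) = v\<close> and likewise with the summands
    exchanged.\<close>
  have 2: "s' ''D'' (i * n + m) = floyd d m i m" "s' ''D'' (m * n + j) = floyd d m m j"
    "s' ''D'' (i * n + j) = floyd d m i j"
    using D ij m d by auto
  show "result relax_body s' = s'(''D'' := (s' ''D'')(i * n + j := floyd d (Suc m) i j))"
    unfolding relax_body_def using 1 * 2 by (auto simp: min_def fun_upd_idem)
qed (auto simp: relax_body_def)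

lemma runs_comp_floyd:
  assumes sz: "sized n k s"
  shows "runs comp_floyd s (for_time n (for2_time n 50)) (\<lambda>s'. same {''m'', ''i'', ''j'', ''D''} s s' \<and>
    (\<forall>x < n. \<forall>y < n. s' ''D'' (x * n + y) = floyd (\<lambda>x y. s ''D'' (x * n + y)) n x y))"
  unfolding comp_floyd_def
proof (rule runs_For[where I = "\<lambda>t s'. same {''m'', ''i'', ''j'', ''D''} s s' \<and>
    (\<forall>x < n. \<forall>y < n. s' ''D'' (x * n + y) = floyd (\<lambda>x y. s ''D'' (x * n + y)) t x y)"], goal_cases)
  case (1 t s')
  then have "same {''m'', ''i'', ''j'', ''D''} s s'" by blast
  from sameD[OF this, of "''n''"] show ?case using sizedD[OF sz] by simp
next
  case (2 t s')
  then have "sized n k s'" using sz sized_same[of "{''m'', ''i'', ''j'', ''D''}" s s'] by simp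
  then have run: "runs (For2 relax_body) s' (for2_time n 50) (\<lambda>s''. same {''i'', ''j'', ''D''} s' s'' \<and>
      (\<forall>x < n. \<forall>y < n. s'' ''D'' (x * n + y) = floyd (\<lambda>x y. s ''D'' (x * n + y)) (Suc t) x y))"
    by (rule runs_relax) (use 2 in auto)
  show ?case
  proof (rule runs_weaken[OF run order.refl], elim conjE, intro conjI)
    fix s'' assume same: "same {''i'', ''j'', ''D''} s' s''"
      and D: "\<forall>x < n. \<forall>y < n. s'' ''D'' (x * n + y) = floyd (\<lambda>x y. s ''D'' (x * n + y)) (Suc t) x y"
    show "s'' ''m'' 0 = t" using sameD[OF same, of "''m''"] 2 by simp
    have "same {''m'', ''i'', ''j'', ''D''} s s''"
      by (rule same_trans[OF conjunct1[OF 2(2)] same]) auto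
    then show "same {''m'', ''i'', ''j'', ''D''} s (s''(''m'' := (s'' ''m'')(0 := Suc t)))"
      by (simp add: same_upd)
    show "\<forall>x < n. \<forall>y < n. (s''(''m'' := (s'' ''m'')(0 := Suc t))) ''D'' (x * n + y) =
        floyd (\<lambda>x y. s ''D'' (x * n + y)) (Suc t) x y"
      using D by (simp del: floyd.simps)
  qed
qed (auto simp: same_upd same_refl)

definition tab :: "nat \<Rightarrow> (nat \<Rightarrow> nat) \<Rightarrow> nat \<Rightarrow> nat \<Rightarrow> nat \<Rightarrow> nat" where
  "tab n f b x y = f (b + (x * n + y))"

definition summand :: "vname \<Rightarrow> vname \<Rightarrow> aexp" where
  "summand A B = Plus (Read A (idx ''i'' ''m'')) (Read B (Plus (var ''o'') (idx ''m'' ''j'')))"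

definition store_summand :: "vname \<Rightarrow> vname \<Rightarrow> vname \<Rightarrow> vname \<Rightarrow> com" where
  "store_summand A B C P = Seq (Write C (Plus (var ''oc'') (idx ''i'' ''j'')) (summand A B))
     (Write P (Plus (var ''o'') (idx ''i'' ''j'')) (var ''m''))"

text \<open>The summand for \<open>m = 0\<close> is stored first, so that no infinite start value is
  needed; the loop then examines it once more without effect.\<close>

definition product_entry :: "vname \<Rightarrow> vname \<Rightarrow> vname \<Rightarrow> vname \<Rightarrow> com" where
  "product_entry A B C P = Seq (Seq (assign ''m'' (N 0)) (store_summand A B C P))
     (For ''m'' ''n'' (If (Less (summand A B) (Read C (Plus (var ''oc'') (idx ''i'' ''j'')))) (store_summand A B C P) Skip))"

definition product :: "vname \<Rightarrow> vname \<Rightarrow> vname \<Rightarrow> vname \<Rightarrow> com" where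
  "product A B C P = For2 (product_entry A B C P)"

text \<open>\<open>B\<close> and \<open>C\<close> may be the same array, provided the block written
  starts right after the block read. This is how the next layer of \<open>D\<close> is computed from
  the previous one.\<close>

lemma runs_product:
  assumes sz: "sized n k s" and o: "s ''o'' 0 = ob" "s ''oc'' 0 = oc"
    and names: "{A, B, C, P} \<inter> {''n'', ''k'', ''nn'', ''R'', ''i'', ''j'', ''m'', ''o'', ''oc''} = {}"
      "A \<noteq> C" "A \<noteq> P" "B \<noteq> P" "C \<noteq> P" and disj: "B \<noteq> C \<or> oc = ob + n * n"
  shows "runs (product A B C P) s (for2_time n (80 + for_time n 80)) (\<lambda>s'. same {''i'', ''j'', ''m'', C, P} s s' \<and>
      min_plus n (tab n (s A) 0) (tab n (s B) ob) (tab n (s' C) oc) (tab n (s' P) ob) \<and>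
      (\<forall>q < oc. s' C q = s C q) \<and> (\<forall>q < ob. s' P q = s P q))"
proof -
  let ?X = "{''i'', ''j'', ''m'', C, P}"
  define val where "val x m y = s A (x * n + m) + s B (ob + (m * n + y))" for x m y
  \<comment> \<open>The minimum is only claimed over indices below \<open>u\<close>; for
    \<open>u = 0\<close> what remains is that the stored value matches the stored index.\<close>
  define entry where "entry x y u s' \<longleftrightarrow> s' P (ob + (x * n + y)) < n \<and>
      s' C (oc + (x * n + y)) = val x (s' P (ob + (x * n + y))) y \<and> (\<forall>m < u. s' C (oc + (x * n + y)) \<le> val x m y)"
    for x y u and s' :: state
  define I where "I t s' \<longleftrightarrow> same ?X s s' \<and> (\<forall>x < n. \<forall>y < n. x * n + y < t \<longrightarrow> entry x y n s') \<and>
    (\<forall>q < oc. s' C q = s C q) \<and> (\<forall>q < ob. s' P q = s P q)" for t and s' :: state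
  have var: "s' ''n'' 0 = n" "s' ''o'' 0 = ob" "s' ''oc'' 0 = oc" "x \<le> n \<Longrightarrow> s' ''R'' x = x * n"
    if "I t s'" for t s' x
  proof -
    have same: "same ?X s s'" using that by (simp add: I_def)
    show "s' ''n'' 0 = n" "s' ''o'' 0 = ob" "s' ''oc'' 0 = oc" "x \<le> n \<Longrightarrow> s' ''R'' x = x * n"
      using sameD[OF same, of "''n''"] sameD[OF same, of "''o''"] sameD[OF same, of "''oc''"]
        sameD[OF same, of "''R''"] sizedD[OF sz] o names by auto
  qed
  have entry_upd: "entry x y u (s'(v := f)) = entry x y u s'" if "v \<in> {''i'', ''j'', ''m''}" for x y u s' v f
    using that names by (auto simp: entry_def)
  have I_upd: "I t (s'(v := f)) = I t s'" if "v \<in> {''i'', ''j'', ''m''}" for t s' v f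
    using that names entry_upd[OF that] by (auto simp: I_def same_upd)
  have aval_term: "aval (summand A B) s' = val i m j"
    if "I t s'" "s' ''i'' 0 = i" "s' ''j'' 0 = j" "s' ''m'' 0 = m" "i < n" "j < n" "m < n" for t s' i j m
  proof -
    have same: "same ?X s s'" using that by (simp add: I_def)
    have "s' A = s A" using sameD[OF same, of A] names by auto
    moreover have "s' B (ob + (m * n + j)) = s B (ob + (m * n + j))"
    proof (cases "B = C")
      case True
      \<comment> \<open>The cells read lie below \<open>oc\<close>, and only cells from
        \<open>oc\<close> on have been overwritten.\<close>
      then show ?thesis using disj that index_less[of m n j] by (auto simp: I_def)
    next
      case False
      then show ?thesis using sameD[OF same, of B] names by auto
    qed
    ultimately show ?thesis using that var[OF that(1)] by (simp add: summand_def val_def)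
  qed
  have store: "I (i * n + j) (result (store_summand A B C P) s') \<and> result (store_summand A B C P) s' v 0 = s' v 0 \<and>
      result (store_summand A B C P) s' C (oc + (i * n + j)) = val i m j \<and>
      result (store_summand A B C P) s' P (ob + (i * n + j)) = m"
    if I: "I (i * n + j) s'" and s': "s' ''i'' 0 = i" "s' ''j'' 0 = j" "s' ''m'' 0 = m"
      and lt: "i < n" "j < n" "m < n" and v: "v \<in> {''i'', ''j'', ''m''}" for s' i j m v
  proof -
    have res: "result (store_summand A B C P) s' =
      s'(C := (s' C)(oc + (i * n + j) := val i m j), P := (s' P)(ob + (i * n + j) := m))"
      using aval_term[OF I s' lt] s' lt var[OF I] names by (simp add: store_summand_def)
    have "entry x y n (result (store_summand A B C P) s')" if "x < n" "y < n" "x * n + y < i * n + j" for x y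
    proof -
      have "entry x y n s'" using that I by (simp add: I_def)
      moreover have "entry x y n (result (store_summand A B C P) s') = entry x y n s'"
        unfolding entry_def res using that(3) names by auto
      ultimately show ?thesis by simp
    qed
    then show ?thesis using I names v by (auto simp: res I_def same_upd)
  qed
  have run: "runs (product A B C P) s (for2_time n (80 + for_time n 80)) (I (n * n))"
    unfolding product_def
  proof (rule runs_For2[where I = I])
    fix i j s' assume lt: "i < n" "j < n" and I: "I (i * n + j) s'" and s': "s' ''i'' 0 = i" "s' ''j'' 0 = j"
    let ?J = "\<lambda>u s'. I (i * n + j) s' \<and> s' ''i'' 0 = i \<and> s' ''j'' 0 = j \<and> entry i j u s'"
    let ?s1 = "s'(''m'' := (s' ''m'')(0 := 0))"
    have I1: "I (i * n + j) ?s1" using I by (simp add: I_upd)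
    have J0: "?J 0 (result (store_summand A B C P) ?s1)"
      using store[OF I1, of 0 "''i''"] store[OF I1, of 0 "''j''"] s' lt by (auto simp: entry_def)
    have 1: "runs (Seq (assign ''m'' (N 0)) (store_summand A B C P)) s' 80 (?J 0)"
      using J0 by (intro runs_body) (auto simp: store_summand_def summand_def)
    have 2: "runs (For ''m'' ''n'' (If (Less (summand A B) (Read C (Plus (var ''oc'') (idx ''i'' ''j'')))) (store_summand A B C P) Skip))
       s2 (for_time n 80) (?J n)" if "?J 0 s2" for s2
    proof (rule runs_For[where I = ?J])
      fix t s3 assume "?J t s3"
      then show "s3 ''n'' 0 = n" using var by blast
    next
      fix t s3 assume t: "t < n" "?J t s3" "s3 ''m'' 0 = t"
      then have I3: "I (i * n + j) s3" and s3: "s3 ''i'' 0 = i" "s3 ''j'' 0 = j" by auto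
      let ?b = "If (Less (summand A B) (Read C (Plus (var ''oc'') (idx ''i'' ''j'')))) (store_summand A B C P) Skip"
      have tm: "aval (summand A B) s3 = val i t j" using aval_term[OF I3 s3 t(3) lt t(1)] .
      have "?J (Suc t) (result ?b s3) \<and> result ?b s3 ''m'' 0 = t"
      proof (cases "val i t j < s3 C (oc + (i * n + j))")
        case True
        then have res: "result ?b s3 = result (store_summand A B C P) s3"
          using tm s3 var[OF I3] lt by simp
        note st = store[OF I3 s3 t(3) lt t(1)]
        show ?thesis unfolding res
          using st[of "''i''"] st[of "''j''"] st[of "''m''"] t s3 True
          by (auto simp: entry_def less_Suc_eq)
      next
        case False
        then have "result ?b s3 = s3" using tm s3 var[OF I3] lt by simp
        then show ?thesis using t False by (auto simp: entry_def less_Suc_eq)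
      qed
      then show "runs ?b s3 80 (\<lambda>s'. s' ''m'' 0 = t \<and> ?J (Suc t) (s'(''m'' := (s' ''m'')(0 := Suc t))))"
        by (intro runs_body) (auto simp: store_summand_def summand_def I_upd entry_upd)
    qed (use that in \<open>auto simp: I_upd entry_upd\<close>)
    have "runs (product_entry A B C P) s' (80 + for_time n 80) (?J n)"
      unfolding product_entry_def by (rule runs_Seq[OF 1 2])
    then show "runs (product_entry A B C P) s' (80 + for_time n 80)
        (\<lambda>s'. s' ''i'' 0 = i \<and> s' ''j'' 0 = j \<and> I (Suc (i * n + j)) s')"
      by (rule runs_weaken) (use lt in \<open>auto simp: I_def index_less_Suc\<close>)
  next
    show "I 0 s" by (simp add: I_def same_refl)
  qed (simp_all add: I_upd var(1))
  have "min_plus n (tab n (s A) 0) (tab n (s B) ob) (tab n (s' C) oc) (tab n (s' P) ob)"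
    if "I (n * n) s'" for s'
    unfolding min_plus_def tab_def
  proof (intro allI impI)
    fix x y assume "x < n" "y < n"
    then have "entry x y n s'" using that index_less[of x n y] by (simp add: I_def)
    then show "s' P (ob + (x * n + y)) < n \<and> s' C (oc + (x * n + y)) =
        s A (0 + (x * n + s' P (ob + (x * n + y)))) + s B (ob + (s' P (ob + (x * n + y)) * n + y)) \<and>
        (\<forall>m<n. s' C (oc + (x * n + y)) \<le> s A (0 + (x * n + m)) + s B (ob + (m * n + y)))"
      unfolding entry_def val_def add_0_left .
  qed
  then show ?thesis by (intro runs_weaken[OF run order.refl]) (simp add: I_def)
qed

text \<open>Layer \<open>l\<close> of the arrays \<open>D\<close> and \<open>P\<close> starts at index \<open>l * n * n\<close>; layer 0 of \<open>D\<close> is the result of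
  \<open>comp_floyd\<close>.\<close>

definition "next_layer = Seq (assign ''oc'' (Plus (var ''o'') (var ''nn'')))
   (Seq (product ''c'' ''D'' ''D'' ''P'') (assign ''o'' (var ''oc'')))"

definition "comp_layers = Seq (Seq (assign ''o'' (N 0)) (assign ''oc'' (N 0)))
  (Seq (product ''D'' ''w'' ''c'' ''Q'') (For ''l'' ''k'' next_layer))"

definition "layer_vars = {''o'', ''oc'', ''i'', ''j'', ''m'', ''l'', ''c'', ''D'', ''P'', ''Q''}"

lemma runs_comp_layers:
  assumes sz: "sized n k s"
  shows "runs comp_layers s (6 + (for2_time n (80 + for_time n 80) + for_time k (20 + for2_time n (80 + for_time n 80))))
    (\<lambda>s'. same layer_vars s s' \<and> s' ''o'' 0 = k * (n * n) \<and>
      (\<forall>q < n * n. s' ''D'' q = s ''D'' q) \<and>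
      min_plus n (tab n (s' ''D'') 0) (tab n (s ''w'') 0) (tab n (s' ''c'') 0) (tab n (s' ''Q'') 0) \<and>
      (\<forall>l < k. min_plus n (tab n (s' ''c'') 0) (tab n (s' ''D'') (l * (n * n)))
         (tab n (s' ''D'') (Suc l * (n * n))) (tab n (s' ''P'') (l * (n * n)))))"
  unfolding comp_layers_def
proof (rule runs_Seq)
  show "runs (Seq (assign ''o'' (N 0)) (assign ''oc'' (N 0))) s 6
      (\<lambda>s'. same {''o'', ''oc''} s s' \<and> s' ''o'' 0 = 0 \<and> s' ''oc'' 0 = 0)"
    by (rule runs_body) (auto simp: same_upd same_refl)
next
  fix s1 assume 2: "same {''o'', ''oc''} s s1 \<and> s1 ''o'' 0 = 0 \<and> s1 ''oc'' 0 = 0"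
  have sz1: "sized n k s1" using 2 sz sized_same[of "{''o'', ''oc''}" s s1] by simp
  let ?I = "\<lambda>t s'. same layer_vars s s' \<and> s' ''o'' 0 = t * (n * n) \<and>
      (\<forall>q < n * n. s' ''D'' q = s ''D'' q) \<and>
      min_plus n (tab n (s' ''D'') 0) (tab n (s ''w'') 0) (tab n (s' ''c'') 0) (tab n (s' ''Q'') 0) \<and>
      (\<forall>l < t. min_plus n (tab n (s' ''c'') 0) (tab n (s' ''D'') (l * (n * n)))
         (tab n (s' ''D'') (Suc l * (n * n))) (tab n (s' ''P'') (l * (n * n))))"
  show "runs (Seq (product ''D'' ''w'' ''c'' ''Q'') (For ''l'' ''k'' next_layer)) s1
      (for2_time n (80 + for_time n 80) + for_time k (20 + for2_time n (80 + for_time n 80))) (?I k)"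
  proof (rule runs_Seq, rule runs_product[OF sz1, of 0 0])
    fix s2 assume s2: "same {''i'', ''j'', ''m'', ''c'', ''Q''} s1 s2 \<and>
      min_plus n (tab n (s1 ''D'') 0) (tab n (s1 ''w'') 0) (tab n (s2 ''c'') 0) (tab n (s2 ''Q'') 0) \<and>
      (\<forall>q < 0. s2 ''c'' q = s1 ''c'' q) \<and> (\<forall>q < 0. s2 ''Q'' q = s1 ''Q'' q)"
    have sz_I: "sized n k s'" if "?I t s'" for t s'
      using that sz sized_same[of layer_vars s s'] by (simp add: layer_vars_def)
    show "runs (For ''l'' ''k'' next_layer) s2 (for_time k (20 + for2_time n (80 + for_time n 80))) (?I k)"
    proof (rule runs_For[where I = ?I])
      fix t s' assume "?I t s'"
      then show "s' ''k'' 0 = k" using sz_I sizedD(2) by blast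
    next
      fix t s' assume t: "t < k" and I: "?I t s'"
      have sz': "sized n k s'" using sz_I[OF I] .
      let ?s3 = "s'(''oc'' := (s' ''oc'')(0 := Suc t * (n * n)))"
      have 1: "runs (assign ''oc'' (Plus (var ''o'') (var ''nn''))) s' 10 (\<lambda>s'. s' = ?s3)"
        using sizedD(3)[OF sz'] I by (intro runs_body) (auto simp: add.commute)
      have sz3: "sized n k ?s3" using sz' by (simp add: sized_def)
      have o3: "?s3 ''o'' 0 = t * (n * n)" "?s3 ''oc'' 0 = Suc t * (n * n)" using I by auto
      note P = runs_product[OF sz3 o3, of "''c''" "''D''" "''D''" "''P''"]
      let ?Q4 = "\<lambda>s4. same {''i'', ''j'', ''m'', ''D'', ''P''} ?s3 s4 \<and>
          min_plus n (tab n (?s3 ''c'') 0) (tab n (?s3 ''D'') (t * (n * n))) (tab n (s4 ''D'') (Suc t * (n * n)))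
            (tab n (s4 ''P'') (t * (n * n))) \<and>
          (\<forall>q < Suc t * (n * n). s4 ''D'' q = ?s3 ''D'' q) \<and> (\<forall>q < t * (n * n). s4 ''P'' q = ?s3 ''P'' q)"
      have 3: "runs (assign ''o'' (var ''oc'')) s4 10
          (\<lambda>s'. s' ''l'' 0 = s4 ''l'' 0 \<and> ?I (Suc t) (s'(''l'' := (s' ''l'')(0 := Suc t))))" if s4: "?Q4 s4" for s4
      proof (rule runs_body)
        have eq: "s4 ''c'' = s' ''c''" "s4 ''Q'' = s' ''Q''" "s4 ''oc'' 0 = Suc t * (n * n)"
          using sameD[OF conjunct1[OF s4]] by simp_all
        have "same layer_vars s ?s3" using I by (simp add: same_upd layer_vars_def)
        then have same4: "same layer_vars s s4"
          by (rule same_trans[OF _ conjunct1[OF s4]]) (auto simp: layer_vars_def)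
        \<comment> \<open>Layers up to \<open>t\<close> end where the newly written block starts, so
          the products established earlier remain valid; the same holds for \<open>P\<close> one
          layer lower.\<close>
        have D: "tab n (s4 ''D'') (l * (n * n)) x y = tab n (s' ''D'') (l * (n * n)) x y"
          if "l \<le> t" "x < n" "y < n" for l x y
        proof -
          have "l * (n * n) + (x * n + y) < l * (n * n) + n * n" using index_less[OF that(2,3)] by simp
          also have "\<dots> \<le> Suc t * (n * n)" using that(1) mult_le_mono1[of "Suc l" "Suc t" "n * n"] by simp
          finally show ?thesis using s4 by (simp add: tab_def)
        qed
        have Pt: "tab n (s4 ''P'') (l * (n * n)) x y = tab n (s' ''P'') (l * (n * n)) x y"
          if "l < t" "x < n" "y < n" for l x y
        proof -
          have "l * (n * n) + (x * n + y) < l * (n * n) + n * n" using index_less[OF that(2,3)] by simp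
          also have "\<dots> \<le> t * (n * n)" using that(1) mult_le_mono1[of "Suc l" t "n * n"] by simp
          finally show ?thesis using s4 by (simp add: tab_def)
        qed
        have "min_plus n (tab n (s4 ''c'') 0) (tab n (s4 ''D'') (l * (n * n)))
            (tab n (s4 ''D'') (Suc l * (n * n))) (tab n (s4 ''P'') (l * (n * n)))" if "l < Suc t" for l
        proof (cases "l = t")
          case True
          show ?thesis unfolding True eq
            by (rule min_plus_cong[OF conjunct1[OF conjunct2[OF s4]]]) (use D[of t] in \<open>auto simp: eq\<close>)
        next
          case False
          then have "l < t" using that by simp
          then have "min_plus n (tab n (s' ''c'') 0) (tab n (s' ''D'') (l * (n * n)))
            (tab n (s' ''D'') (Suc l * (n * n))) (tab n (s' ''P'') (l * (n * n)))" using I by blast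
          then show ?thesis unfolding eq
            by (rule min_plus_cong) (use \<open>l < t\<close> D[of l] D[of "Suc l"] Pt[of l] in auto)
        qed
        moreover have D0: "s4 ''D'' q = s ''D'' q" if "q < n * n" for q
        proof -
          have "q < Suc t * (n * n)" using that mult_le_mono1[of 1 "Suc t" "n * n"] by simp
          then show ?thesis using s4 I that by simp
        qed
        moreover have "min_plus n (tab n (s4 ''D'') 0) (tab n (s ''w'') 0) (tab n (s4 ''c'') 0) (tab n (s4 ''Q'') 0)"
        proof -
          have "min_plus n (tab n (s' ''D'') 0) (tab n (s ''w'') 0) (tab n (s' ''c'') 0) (tab n (s' ''Q'') 0)"
            using I by blast
          then show ?thesis unfolding eq by (rule min_plus_cong) (use D[of 0] in auto)
        qed
        ultimately show "result (assign ''o'' (var ''oc'')) s4 ''l'' 0 = s4 ''l'' 0 \<and>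
            ?I (Suc t) ((result (assign ''o'' (var ''oc'')) s4)(''l'' := (result (assign ''o'' (var ''oc'')) s4 ''l'')(0 := Suc t)))"
          using same4 eq by (simp add: same_upd layer_vars_def)
      qed auto
      assume l: "s' ''l'' 0 = t"
      have "runs next_layer s' (10 + (for2_time n (80 + for_time n 80) + 10))
        (\<lambda>s'. s' ''l'' 0 = t \<and> ?I (Suc t) (s'(''l'' := (s' ''l'')(0 := Suc t))))"
        unfolding next_layer_def
      proof (rule runs_Seq[OF 1], rule runs_Seq)
        fix s5 assume s5: "s5 = ?s3"
        show "runs (product ''c'' ''D'' ''D'' ''P'') s5 (for2_time n (80 + for_time n 80)) ?Q4"
          unfolding s5 by (rule P) simp_all
      next
        fix s4 assume s4: "?Q4 s4"
        then have "same {''i'', ''j'', ''m'', ''D'', ''P''} ?s3 s4" by blast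
        then have "s4 ''l'' 0 = t" using l sameD[of "{''i'', ''j'', ''m'', ''D'', ''P''}" ?s3 s4 "''l''"] by simp
        with 3[OF s4] show "runs (assign ''o'' (var ''oc'')) s4 10
          (\<lambda>s'. s' ''l'' 0 = t \<and> ?I (Suc t) (s'(''l'' := (s' ''l'')(0 := Suc t))))" by simp
      qed
      then show "runs next_layer s' (20 + for2_time n (80 + for_time n 80))
        (\<lambda>s'. s' ''l'' 0 = t \<and> ?I (Suc t) (s'(''l'' := (s' ''l'')(0 := Suc t))))"
        by (rule runs_weaken) auto
    next
      from 2 s2 have s01: "same {''o'', ''oc''} s s1" and s12: "same {''i'', ''j'', ''m'', ''c'', ''Q''} s1 s2" by blast+
      have "same layer_vars s s2" by (rule same_trans[OF s01 s12]) (auto simp: layer_vars_def)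
      moreover have "s2 ''D'' = s1 ''D''" "s1 ''D'' = s ''D''" "s1 ''w'' = s ''w''" "s2 ''o'' = s1 ''o''"
        using sameD[OF s01] sameD[OF s12] by simp_all
      ultimately show "?I 0 (s2(''l'' := (s2 ''l'')(0 := 0)))" using 2 s2 by (simp add: same_upd layer_vars_def)
    qed
  qed (use 2 in simp_all)
qed

section \<open>The greedy rounds\<close>

definition "select = Seq (Seq (assign ''x'' (N 0)) (assign ''y'' (N 0)))
  (For2 (If (Less (Read ''H'' (idx ''x'' ''y'')) (Read ''H'' (idx ''i'' ''j'')))
    (Seq (assign ''x'' (var ''i'')) (assign ''y'' (var ''j''))) Skip))"

lemma runs_select:
  assumes sz: "sized n k s" and n: "0 < n"
  shows "runs select s (10 + for2_time n 60) (\<lambda>s'. same {''i'', ''j'', ''x'', ''y''} s s' \<and>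
    s' ''x'' 0 < n \<and> s' ''y'' 0 < n \<and>
    (\<forall>u < n. \<forall>v < n. s ''H'' (u * n + v) \<le> s ''H'' (s' ''x'' 0 * n + s' ''y'' 0)))"
  unfolding select_def
proof (rule runs_Seq)
  let ?s = "s(''x'' := (s ''x'')(0 := 0), ''y'' := (s ''y'')(0 := 0))"
  show "runs (Seq (assign ''x'' (N 0)) (assign ''y'' (N 0))) s 10 (\<lambda>s'. s' = ?s)"
    by (rule runs_body) simp_all
  fix s1 assume s1: "s1 = ?s"
  let ?I = "\<lambda>t s'. same {''i'', ''j'', ''x'', ''y''} s s' \<and> s' ''x'' 0 < n \<and> s' ''y'' 0 < n \<and>
    (\<forall>u < n. \<forall>v < n. u * n + v < t \<longrightarrow> s ''H'' (u * n + v) \<le> s ''H'' (s' ''x'' 0 * n + s' ''y'' 0))"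
  let ?b = "If (Less (Read ''H'' (idx ''x'' ''y'')) (Read ''H'' (idx ''i'' ''j'')))
    (Seq (assign ''x'' (var ''i'')) (assign ''y'' (var ''j''))) Skip"
  have "runs (For2 ?b) s1 (for2_time n 60) (?I (n * n))"
  proof (rule runs_For2[where I = ?I])
    fix t s' assume "?I t s'"
    then have "same {''i'', ''j'', ''x'', ''y''} s s'" by blast
    from sameD[OF this, of "''n''"] show "s' ''n'' 0 = n" using sizedD[OF sz] by simp
  next
    fix i j s' assume lt: "i < n" "j < n" and I: "?I (i * n + j) s'" and s': "s' ''i'' 0 = i" "s' ''j'' 0 = j"
    then have same: "same {''i'', ''j'', ''x'', ''y''} s s'" by blast
    have HR: "s' ''H'' = s ''H''" "s' ''R'' i = i * n" "s' ''R'' (s' ''x'' 0) = s' ''x'' 0 * n"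
      using sameD[OF same, of "''H''"] sameD[OF same, of "''R''"] sizedD(4)[OF sz] lt I by simp_all
    have "s ''H'' (u * n + v) \<le> s ''H'' (i * n + j)"
      if "s ''H'' (s' ''x'' 0 * n + s' ''y'' 0) < s ''H'' (i * n + j)" "u < n" "v < n" "u * n + v < i * n + j" for u v
      using I that by (meson le_trans less_imp_le)
    then show "runs ?b s' 60 (\<lambda>s'. s' ''i'' 0 = i \<and> s' ''j'' 0 = j \<and> ?I (Suc (i * n + j)) s')"
      using I s' HR lt by (intro runs_body) (auto simp: same_upd index_less_Suc)
  qed (use n in \<open>simp_all add: same_upd s1 same_refl\<close>)
  then show "runs (For2 ?b) s1 (for2_time n 60) (\<lambda>s'. same {''i'', ''j'', ''x'', ''y''} s s' \<and>
    s' ''x'' 0 < n \<and> s' ''y'' 0 < n \<and>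
    (\<forall>u < n. \<forall>v < n. s ''H'' (u * n + v) \<le> s ''H'' (s' ''x'' 0 * n + s' ''y'' 0)))"
    by (rule runs_weaken) (auto simp: index_less)
qed

definition "detour_exp x y = Plus (Plus (Read ''D'' (idx ''i'' x)) (var ''L'')) (Read ''D'' (idx y ''j''))"

definition "lower e = If (Less e (Read ''H'' (idx ''i'' ''j''))) (Write ''H'' (idx ''i'' ''j'') e) Skip"

definition "update_H = For2 (Seq (lower (detour_exp ''x'' ''y'')) (lower (detour_exp ''y'' ''x'')))"

lemma runs_update_H:
  assumes sz: "sized n k s" and xy: "s ''x'' 0 = x" "s ''y'' 0 = y" "x < n" "y < n" and L: "s ''L'' 0 = L"
  shows "runs update_H s (for2_time n 120) (\<lambda>s'. same {''i'', ''j'', ''H''} s s' \<and>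
    (\<forall>u < n. \<forall>v < n. s' ''H'' (u * n + v) = min (s ''H'' (u * n + v))
      (min (s ''D'' (u * n + x) + L + s ''D'' (y * n + v)) (s ''D'' (u * n + y) + L + s ''D'' (x * n + v)))))"
  unfolding update_H_def
proof (rule runs_fill[OF sz])
  fix i j s' assume ij: "i < n" "j < n" and I: "same {''i'', ''j'', ''H''} s s'"
    and *: "s' ''i'' 0 = i" "s' ''j'' 0 = j"
    and H: "\<And>u v. u < n \<Longrightarrow> v < n \<Longrightarrow> s' ''H'' (u * n + v) = (if u * n + v < i * n + j then
       min (s ''H'' (u * n + v)) (min (s ''D'' (u * n + x) + L + s ''D'' (y * n + v))
        (s ''D'' (u * n + y) + L + s ''D'' (x * n + v))) else s ''H'' (u * n + v))"
  have R: "s' ''R'' u = u * n" if "u < n" for u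
    using sameD[OF I, of "''R''"] sizedD(4)[OF sz] that by simp
  have eq: "s' ''D'' = s ''D''" "s' ''L'' 0 = L" "s' ''x'' 0 = x" "s' ''y'' 0 = y"
    using sameD[OF I] xy L by simp_all
  show "result (Seq (lower (detour_exp ''x'' ''y'')) (lower (detour_exp ''y'' ''x''))) s' =
    s'(''H'' := (s' ''H'')(i * n + j := min (s ''H'' (i * n + j))
      (min (s ''D'' (i * n + x) + L + s ''D'' (y * n + j)) (s ''D'' (i * n + y) + L + s ''D'' (x * n + j)))))"
    using R ij xy eq * H[OF ij] by (auto simp: lower_def detour_exp_def min_def fun_upd_idem)
qed (auto simp: lower_def detour_exp_def)

text \<open>\<open>S\<close> itself may contain singletons and edges of \<open>E\<close>, so
  unfiltered routes can be collected in it, or even \<open>UNIV\<close>; the array shows only its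
  non-edges.\<close>

definition marks :: "nat \<Rightarrow> nat set set \<Rightarrow> (nat \<Rightarrow> nat) \<Rightarrow> nat set set \<Rightarrow> bool" where
  "marks n E f S \<longleftrightarrow> (\<forall>x < n. \<forall>y < n. f (x * n + y) = of_bool ({x, y} \<in> S \<inter> non_edges {0..<n} E))"

definition "mark_edge = If (Eq (var ''r'') (var ''m'')) Skip
    (If (Less (N 0) (Read ''E'' (idx ''r'' ''m''))) Skip
      (Seq (Write ''F'' (idx ''r'' ''m'') (N 1)) (Write ''F'' (idx ''m'' ''r'') (N 1))))"

text \<open>\<open>a\<close> is the offset of the current layer and is lowered before the read, as
  \<open>route\<close> at \<open>Suc l\<close> consults layer \<open>l\<close> of \<open>P\<close>.
  The layers are thus visited from the top down.\<close>

definition "fetch_edge = Seq (assign ''a'' (Minus (var ''a'') (var ''nn'')))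
  (Seq (assign ''m'' (Read ''P'' (Plus (var ''a'') (idx ''z'' ''y''))))
  (assign ''r'' (Read ''Q'' (idx ''z'' ''m''))))"

definition "route_step = Seq fetch_edge (Seq mark_edge (assign ''z'' (var ''m'')))"

lemma result_mark_edge:
  assumes sz: "sized n k s" and m: "s ''m'' 0 = m" "m < n" and r: "s ''r'' 0 = r" "r < n"
    and E: "\<forall>x < n. \<forall>y < n. s ''E'' (x * n + y) = of_bool ({x, y} \<in> E)"
    and S: "marks n E (s ''F'') S"
  shows "same {''F''} s (result mark_edge s)" "marks n E (result mark_edge s ''F'') (insert {r, m} S)"
proof -
  have R: "s ''R'' m = m * n" "s ''R'' r = r * n" using sizedD(4)[OF sz] m r by simp_all
  show "same {''F''} s (result mark_edge s)" by (simp add: mark_edge_def same_upd same_refl)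
  show "marks n E (result mark_edge s ''F'') (insert {r, m} S)"
  proof (cases "r = m \<or> {r, m} \<in> E")
    case True
    then have "insert {r, m} S \<inter> non_edges {0..<n} E = S \<inter> non_edges {0..<n} E"
      by (auto simp: non_edges_def pairs_def)
    moreover have "result mark_edge s = s" using True R m r E by (auto simp: mark_edge_def)
    ultimately show ?thesis using S by (simp add: marks_def)
  next
    case False
    then have "{r, m} \<in> non_edges {0..<n} E" using m r by (auto simp: non_edges_def pairs_def)
    moreover have "result mark_edge s ''F'' = (s ''F'')(r * n + m := 1, m * n + r := 1)"
      using False R m r E by (auto simp: mark_edge_def)
    moreover have "((s ''F'')(r * n + m := 1, m * n + r := 1)) (x * n + y) =
        of_bool ({x, y} = {r, m} \<or> {x, y} \<in> S \<inter> non_edges {0..<n} E)" if "x < n" "y < n" for x y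
    proof -
      have eq: "{x, y} = {r, m} \<longleftrightarrow> x * n + y = r * n + m \<or> x * n + y = m * n + r"
        unfolding doubleton_eq_iff index_eq_iff[OF that(2) m(2)] index_eq_iff[OF that(2) r(2)] ..
      have F: "s ''F'' (x * n + y) = of_bool ({x, y} \<in> S \<inter> non_edges {0..<n} E)"
        using S that by (simp add: marks_def)
      show ?thesis
        by (cases "x * n + y = r * n + m"; cases "x * n + y = m * n + r")
          (simp_all only: fun_upd_apply eq F simp_thms if_True if_False of_bool_eq)
    qed
    ultimately show ?thesis by (simp add: marks_def)
  qed
qed

lemma runs_route_step:
  assumes sz: "sized n k s" and a: "s ''a'' 0 = Suc l * (n * n)" and z: "s ''z'' 0 = z" "z < n"
    and y: "s ''y'' 0 = y" "y < n"
    and P: "tab n (s ''P'') (l * (n * n)) z y = m" "m < n" and Q: "tab n (s ''Q'') 0 z m = r" "r < n"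
    and E: "\<forall>x < n. \<forall>y < n. s ''E'' (x * n + y) = of_bool ({x, y} \<in> E)"
    and S: "marks n E (s ''F'') S"
  shows "runs route_step s 120 (\<lambda>s'. same {''a'', ''m'', ''r'', ''F'', ''z''} s s' \<and> s' ''a'' 0 = l * (n * n) \<and>
    s' ''z'' 0 = m \<and> marks n E (s' ''F'') (insert {r, m} S))"
proof (rule runs_body)
  let ?s = "s(''a'' := (s ''a'')(0 := l * (n * n)), ''m'' := (s ''m'')(0 := m), ''r'' := (s ''r'')(0 := r))"
  have sz': "sized n k ?s" using sz by (simp add: sized_def)
  have E': "\<forall>x < n. \<forall>y < n. ?s ''E'' (x * n + y) = of_bool ({x, y} \<in> E)" using E by simp
  have S': "marks n E (?s ''F'') S" using S by simp
  have m': "?s ''m'' 0 = m" and r': "?s ''r'' 0 = r" by simp_all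
  note mark = result_mark_edge[OF sz' m' P(2) r' Q(2) E' S']
  have fetch: "result fetch_edge s = ?s"
    using a z y P Q sizedD(3)[OF sz] sizedD(4)[OF sz, of z] by (simp add: fetch_edge_def tab_def)
  define s' where "s' = result mark_edge ?s"
  have "s' ''m'' 0 = m" "s' ''a'' 0 = l * (n * n)"
    unfolding s'_def by (subst sameD[OF mark(1)], simp_all)+
  moreover from this have "result route_step s = s'(''z'' := (s' ''z'')(0 := m))"
    unfolding route_step_def result.simps fetch aval.simps s'_def by (simp only:)
  moreover have "same {''a'', ''m'', ''r'', ''F'', ''z''} s s'"
  proof -
    have "same {''a'', ''m'', ''r''} s ?s" by (auto simp: same_def)
    then show ?thesis unfolding s'_def by (rule same_trans[OF _ mark(1)]) simp_all
  qed
  moreover have "marks n E (s' ''F'') (insert {r, m} S)" unfolding s'_def by (rule mark(2))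
  ultimately show "same {''a'', ''m'', ''r'', ''F'', ''z''} s (result route_step s) \<and>
    result route_step s ''a'' 0 = l * (n * n) \<and> result route_step s ''z'' 0 = m \<and>
    marks n E (result route_step s ''F'') (insert {r, m} S)"
    by (simp add: same_upd)
qed (simp_all add: route_step_def fetch_edge_def mark_edge_def)

definition "add_route = Seq (Seq (assign ''a'' (var ''o'')) (assign ''z'' (var ''x''))) (For ''l'' ''k'' route_step)"

definition "route_vars = {''a'', ''m'', ''r'', ''F'', ''z'', ''l''}"

lemma runs_add_route:
  assumes sz: "sized n k s" and o: "s ''o'' 0 = k * (n * n)"
    and xy: "s ''x'' 0 = x" "x < n" "s ''y'' 0 = y" "y < n"
    and P: "\<And>l x y. l < k \<Longrightarrow> x < n \<Longrightarrow> y < n \<Longrightarrow> tab n (s ''P'') (l * (n * n)) x y < n"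
    and Q: "\<And>x y. x < n \<Longrightarrow> y < n \<Longrightarrow> tab n (s ''Q'') 0 x y < n"
    and E: "\<forall>x < n. \<forall>y < n. s ''E'' (x * n + y) = of_bool ({x, y} \<in> E)"
    and S: "marks n E (s ''F'') S"
  shows "runs add_route s (10 + for_time k 120) (\<lambda>s'. same route_vars s s' \<and>
    marks n E (s' ''F'') (S \<union> route (\<lambda>l. tab n (s ''P'') (l * (n * n))) (tab n (s ''Q'') 0) k x y))"
  unfolding add_route_def
proof (rule runs_Seq)
  let ?s = "s(''a'' := (s ''a'')(0 := k * (n * n)), ''z'' := (s ''z'')(0 := x))"
  show "runs (Seq (assign ''a'' (var ''o'')) (assign ''z'' (var ''x''))) s 10 (\<lambda>s'. s' = ?s)"
    using o xy by (intro runs_body) simp_all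
  fix s1 assume s1: "s1 = ?s"
  let ?P = "\<lambda>l. tab n (s ''P'') (l * (n * n))"
  let ?Q = "tab n (s ''Q'') 0"
  \<comment> \<open>The marked set together with the rest of the route, from the current vertex
    \<open>z\<close> on, stays constant; at the end that rest is empty.\<close>
  let ?I = "\<lambda>t s'. same route_vars s s' \<and> s' ''a'' 0 = (k - t) * (n * n) \<and> s' ''z'' 0 < n \<and>
    (\<exists>S'. marks n E (s' ''F'') S' \<and> S' \<union> route ?P ?Q (k - t) (s' ''z'' 0) y = S \<union> route ?P ?Q k x y)"
  have "runs (For ''l'' ''k'' route_step) s1 (for_time k 120) (?I k)"
  proof (rule runs_For[where I = ?I])
    fix t s' assume "?I t s'"
    then have "same route_vars s s'" by blast
    from sameD[OF this, of "''k''"] show "s' ''k'' 0 = k" using sizedD[OF sz] by (simp add: route_vars_def)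
  next
    fix t s' assume t: "t < k" and I: "?I t s'" and l: "s' ''l'' 0 = t"
    then have same: "same route_vars s s'" by blast
    have sz': "sized n k s'" using sized_same[OF same] sz by (simp add: route_vars_def)
    have eq: "s' ''P'' = s ''P''" "s' ''Q'' = s ''Q''" "s' ''E'' = s ''E''" "s' ''y'' = s ''y''"
      using sameD[OF same] by (simp_all add: route_vars_def)
    obtain d where d: "k - t = Suc d" using t by (metis Suc_diff_Suc)
    then have d': "d < k" "k - Suc t = d" by linarith+
    obtain S' where S': "marks n E (s' ''F'') S'"
      and union: "S' \<union> route ?P ?Q (Suc d) (s' ''z'' 0) y = S \<union> route ?P ?Q k x y" using I d by auto
    let ?z = "s' ''z'' 0"
    let ?m = "?P d ?z y"
    have z: "?z < n" using I by blast
    have m: "?m < n" using P[OF d'(1) z xy(4)] .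
    have a: "s' ''a'' 0 = Suc d * (n * n)" using I unfolding d by blast
    have "runs route_step s' 120 (\<lambda>s''. same {''a'', ''m'', ''r'', ''F'', ''z''} s' s'' \<and> s'' ''a'' 0 = d * (n * n) \<and>
      s'' ''z'' 0 = ?m \<and> marks n E (s'' ''F'') (insert {?Q ?z ?m, ?m} S'))"
      by (rule runs_route_step[OF sz' a refl z _ xy(4) _ m _ Q[OF z m]]) (use eq xy E S' in simp_all)
    then show "runs route_step s' 120 (\<lambda>s'. s' ''l'' 0 = t \<and> ?I (Suc t) (s'(''l'' := (s' ''l'')(0 := Suc t))))"
    proof (rule runs_weaken, simp, elim conjE, intro conjI)
      fix s'' assume same': "same {''a'', ''m'', ''r'', ''F'', ''z''} s' s''" and a: "s'' ''a'' 0 = d * (n * n)"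
        and z': "s'' ''z'' 0 = ?m" and S'': "marks n E (s'' ''F'') (insert {?Q ?z ?m, ?m} S')"
      let ?t = "s''(''l'' := (s'' ''l'')(0 := Suc t))"
      show "s'' ''l'' 0 = t" using sameD[OF same', of "''l''"] l by simp
      have "same route_vars s s''" by (rule same_trans[OF same same']) (auto simp: route_vars_def)
      then show "same route_vars s ?t" by (simp add: same_upd route_vars_def)
      show "?t ''a'' 0 = (k - Suc t) * (n * n)" using a d' by simp
      show "?t ''z'' 0 < n" using z' m by simp
      have "insert {?Q ?z ?m, ?m} S' \<union> route ?P ?Q d ?m y = S \<union> route ?P ?Q k x y"
        using union by simp
      then show "\<exists>S'. marks n E (?t ''F'') S' \<and> S' \<union> route ?P ?Q (k - Suc t) (?t ''z'' 0) y = S \<union> route ?P ?Q k x y"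
        using S'' z' d' by (intro exI[of _ "insert {?Q ?z ?m, ?m} S'"]) simp
    qed
  next
    show "?I 0 (s1(''l'' := (s1 ''l'')(0 := 0)))"
      using xy S by (auto simp: s1 same_upd same_refl route_vars_def)
  qed
  then show "runs (For ''l'' ''k'' route_step) s1 (for_time k 120) (\<lambda>s'. same route_vars s s' \<and>
    marks n E (s' ''F'') (S \<union> route ?P ?Q k x y))"
    by (rule runs_weaken) auto
qed

definition "greedy_round = Seq select (Seq (assign ''L'' (Read ''D'' (Plus (var ''o'') (idx ''x'' ''y''))))
  (Seq update_H add_route))"

definition "round_time n k = 10 + for2_time n 60 + (20 + (for2_time n 120 + (10 + for_time k 120)))"

definition "round_vars = {''i'', ''j'', ''x'', ''y'', ''L'', ''H''} \<union> route_vars"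

text \<open>\<open>s\<close> is the state in which all distance tables are complete. The frame
  condition keeps them fixed, so in every round they can be read off from \<open>s\<close>.\<close>

definition greedy_inv :: "nat \<Rightarrow> nat \<Rightarrow> nat set set \<Rightarrow> state \<Rightarrow> (nat \<times> nat) list \<Rightarrow> state \<Rightarrow> bool" where
  "greedy_inv n k E s ps s' \<longleftrightarrow> same (round_vars \<union> {''p'', ''q''}) s s' \<and>
     greedy n (tab n (s ''D'') 0) (tab n (s ''D'') (k * (n * n))) ps \<and>
     (\<forall>u < n. \<forall>v < n. s' ''H'' (u * n + v) =
        detour (tab n (s ''D'') 0) (tab n (s ''D'') (k * (n * n))) ps u v) \<and>
     marks n E (s' ''F'') (routes (\<lambda>l. tab n (s ''P'') (l * (n * n))) (tab n (s ''Q'') 0) k ps)"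

lemma runs_greedy_round:
  assumes sz: "sized n k s" and n: "0 < n" and o: "s ''o'' 0 = k * (n * n)"
    and P: "\<And>l x y. l < k \<Longrightarrow> x < n \<Longrightarrow> y < n \<Longrightarrow> tab n (s ''P'') (l * (n * n)) x y < n"
    and Q: "\<And>x y. x < n \<Longrightarrow> y < n \<Longrightarrow> tab n (s ''Q'') 0 x y < n"
    and E: "\<forall>x < n. \<forall>y < n. s ''E'' (x * n + y) = of_bool ({x, y} \<in> E)"
    and I: "greedy_inv n k E s ps s0"
  shows "runs greedy_round s0 (round_time n k)
    (\<lambda>s'. same round_vars s0 s' \<and> (\<exists>p. greedy_inv n k E s (p # ps) s'))"
proof -
  let ?d = "tab n (s ''D'') 0" and ?L = "tab n (s ''D'') (k * (n * n))"
  let ?P = "\<lambda>l. tab n (s ''P'') (l * (n * n))" and ?Q = "tab n (s ''Q'') 0"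
  have same0: "same (round_vars \<union> {''p'', ''q''}) s s0" using I by (simp add: greedy_inv_def)
  have H0: "s0 ''H'' (u * n + v) = detour ?d ?L ps u v" if "u < n" "v < n" for u v
    using I that by (simp add: greedy_inv_def)
  have gr0: "greedy n ?d ?L ps" and F0: "marks n E (s0 ''F'') (routes ?P ?Q k ps)"
    using I by (simp_all add: greedy_inv_def)
  have sz0: "sized n k s0" using sized_same[OF same0] sz by (simp add: round_vars_def route_vars_def)
  have eq0: "s0 ''D'' = s ''D''" "s0 ''P'' = s ''P''" "s0 ''Q'' = s ''Q''" "s0 ''E'' = s ''E''" "s0 ''o'' = s ''o''"
    using sameD[OF same0] by (simp_all add: round_vars_def route_vars_def)
  show ?thesis
    unfolding greedy_round_def round_time_def
  proof (rule runs_Seq[OF runs_select[OF sz0 n]], elim conjE)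
    fix s1 assume same1: "same {''i'', ''j'', ''x'', ''y''} s0 s1" and lt: "s1 ''x'' 0 < n" "s1 ''y'' 0 < n"
      and mx: "\<forall>u < n. \<forall>v < n. s0 ''H'' (u * n + v) \<le> s0 ''H'' (s1 ''x'' 0 * n + s1 ''y'' 0)"
    define x where "x = s1 ''x'' 0"
    define y where "y = s1 ''y'' 0"
    have sz1: "sized n k s1" using sized_same[OF same1] sz0 by simp
    have eq1: "s1 ''D'' = s ''D''" "s1 ''P'' = s ''P''" "s1 ''Q'' = s ''Q''" "s1 ''E'' = s ''E''"
      "s1 ''o'' = s ''o''" "s1 ''H'' = s0 ''H''" "s1 ''F'' = s0 ''F''"
      using sameD[OF same1] eq0 by simp_all
    let ?s2 = "s1(''L'' := (s1 ''L'')(0 := ?L x y))"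
    have sz2: "sized n k ?s2" using sz1 by (simp add: sized_def)
    have 2: "runs (assign ''L'' (Read ''D'' (Plus (var ''o'') (idx ''x'' ''y'')))) s1 20 (\<lambda>s'. s' = ?s2)"
      using eq1 lt o sizedD(4)[OF sz1, of "s1 ''x'' 0"]
      by (intro runs_body) (simp_all add: tab_def x_def y_def)
    have xy2: "?s2 ''x'' 0 = x" "?s2 ''y'' 0 = y" "x < n" "y < n" "?s2 ''L'' 0 = ?L x y"
      using lt by (simp_all add: x_def y_def)
    have 3: "runs (Seq update_H add_route) ?s2 (for2_time n 120 + (10 + for_time k 120))
      (\<lambda>s'. same round_vars s0 s' \<and> greedy_inv n k E s ((x, y) # ps) s')"
    proof (rule runs_Seq[OF runs_update_H[OF sz2 xy2]], elim conjE)
      fix s3 assume same3: "same {''i'', ''j'', ''H''} ?s2 s3"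
        and H3: "\<forall>u < n. \<forall>v < n. s3 ''H'' (u * n + v) = min (?s2 ''H'' (u * n + v))
          (min (?s2 ''D'' (u * n + x) + ?L x y + ?s2 ''D'' (y * n + v))
            (?s2 ''D'' (u * n + y) + ?L x y + ?s2 ''D'' (x * n + v)))"
      have sz3: "sized n k s3" using sized_same[OF same3] sz2 by simp
      have eq3: "s3 ''P'' = s ''P''" "s3 ''Q'' = s ''Q''" "s3 ''E'' = s ''E''"
        "s3 ''o'' = s ''o''" "s3 ''F'' = s0 ''F''" "s3 ''x'' 0 = x" "s3 ''y'' 0 = y"
        using sameD[OF same3] eq1 by (simp_all add: x_def y_def)
      have "same {''L''} s1 ?s2" by (simp add: same_upd same_refl)
      then have "same {''i'', ''j'', ''x'', ''y'', ''L''} s0 ?s2" by (rule same_trans[OF same1]) auto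
      then have same03: "same round_vars s0 s3"
        by (rule same_trans[OF _ same3]) (auto simp: round_vars_def)
      have 4: "runs add_route s3 (10 + for_time k 120) (\<lambda>s'. same route_vars s3 s' \<and>
        marks n E (s' ''F'') (routes ?P ?Q k ps \<union>
          route (\<lambda>l. tab n (s3 ''P'') (l * (n * n))) (tab n (s3 ''Q'') 0) k x y))"
        by (rule runs_add_route[OF sz3 _ _ xy2(3) _ xy2(4)]) (use eq3 o P Q E F0 in simp_all)
      show "runs add_route s3 (10 + for_time k 120)
        (\<lambda>s'. same round_vars s0 s' \<and> greedy_inv n k E s ((x, y) # ps) s')"
      proof (rule runs_weaken[OF 4 order.refl], elim conjE)
        fix s4 assume same4: "same route_vars s3 s4" and F4: "marks n E (s4 ''F'') (routes ?P ?Q k ps \<union>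
          route (\<lambda>l. tab n (s3 ''P'') (l * (n * n))) (tab n (s3 ''Q'') 0) k x y)"
        have same04: "same round_vars s0 s4"
          by (rule same_trans[OF same03 same4]) (auto simp: round_vars_def)
        have "same (round_vars \<union> {''p'', ''q''}) s s4"
          by (rule same_trans[OF same0 same04]) auto
        moreover have "greedy n ?d ?L ((x, y) # ps)" using gr0 mx H0 lt by (simp add: x_def y_def)
        moreover have "s4 ''H'' (u * n + v) = detour ?d ?L ((x, y) # ps) u v" if "u < n" "v < n" for u v
          using sameD[OF same4, of "''H''"] H3 that H0[OF that] eq1
          by (simp add: route_vars_def tab_def)
        moreover have "marks n E (s4 ''F'') (routes ?P ?Q k ((x, y) # ps))"
          using F4 by (simp add: routes_def eq3 Un_commute)
        ultimately show "same round_vars s0 s4 \<and> greedy_inv n k E s ((x, y) # ps) s4"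
          using same04 by (simp add: greedy_inv_def)
      qed
    qed
    show "runs (Seq (assign ''L'' (Read ''D'' (Plus (var ''o'') (idx ''x'' ''y'')))) (Seq update_H add_route)) s1
      (20 + (for2_time n 120 + (10 + for_time k 120)))
      (\<lambda>s'. same round_vars s0 s' \<and> (\<exists>p. greedy_inv n k E s (p # ps) s'))"
    proof (rule runs_Seq[OF 2])
      fix s' assume s': "s' = ?s2"
      show "runs (Seq update_H add_route) s' (for2_time n 120 + (10 + for_time k 120))
        (\<lambda>s'. same round_vars s0 s' \<and> (\<exists>p. greedy_inv n k E s (p # ps) s'))"
        unfolding s' by (rule runs_weaken[OF 3 order.refl]) blast
    qed
  qed
qed

text \<open>Two nested loops up to \<open>k\<close> yield \<open>k * k\<close> rounds without
  computing a product.\<close>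

definition "comp_greedy = Seq (For2 (Write ''H'' (idx ''i'' ''j'') (Read ''D'' (idx ''i'' ''j''))))
  (For ''p'' ''k'' (For ''q'' ''k'' greedy_round))"

lemma greedy_inv_upd:
  assumes "v \<in> {''p'', ''q''}"
  shows "greedy_inv n k E s ps (s'(v := f)) = greedy_inv n k E s ps s'"
  using assms by (auto simp: greedy_inv_def same_upd)

lemma runs_comp_greedy:
  assumes sz: "sized n k s" and n: "0 < n" and o: "s ''o'' 0 = k * (n * n)"
    and P: "\<And>l x y. l < k \<Longrightarrow> x < n \<Longrightarrow> y < n \<Longrightarrow> tab n (s ''P'') (l * (n * n)) x y < n"
    and Q: "\<And>x y. x < n \<Longrightarrow> y < n \<Longrightarrow> tab n (s ''Q'') 0 x y < n"
    and E: "\<forall>x < n. \<forall>y < n. s ''E'' (x * n + y) = of_bool ({x, y} \<in> E)"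
    and F: "\<And>q. s ''F'' q = 0"
  shows "runs comp_greedy s (for2_time n 30 + for_time k (for_time k (round_time n k)))
    (\<lambda>s'. \<exists>ps. length ps = k * k \<and> greedy_inv n k E s ps s')"
  unfolding comp_greedy_def
proof (rule runs_Seq)
  show "runs (For2 (Write ''H'' (idx ''i'' ''j'') (Read ''D'' (idx ''i'' ''j'')))) s (for2_time n 30)
    (\<lambda>s'. same {''i'', ''j'', ''H''} s s' \<and> (\<forall>x < n. \<forall>y < n. s' ''H'' (x * n + y) = s ''D'' (x * n + y)))"
  proof (rule runs_fill[OF sz])
    fix i j s' assume ij: "i < n" "j < n" and I: "same {''i'', ''j'', ''H''} s s'"
      and *: "s' ''i'' 0 = i" "s' ''j'' 0 = j"
    show "result (Write ''H'' (idx ''i'' ''j'') (Read ''D'' (idx ''i'' ''j''))) s' =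
      s'(''H'' := (s' ''H'')(i * n + j := s ''D'' (i * n + j)))"
      using sameD[OF I, of "''R''"] sameD[OF I, of "''D''"] sizedD(4)[OF sz, of i] ij * by simp
  qed auto
next
  fix s1 assume s1: "same {''i'', ''j'', ''H''} s s1 \<and> (\<forall>x < n. \<forall>y < n. s1 ''H'' (x * n + y) = s ''D'' (x * n + y))"
  then have "same {''i'', ''j'', ''H''} s s1" by blast
  then have "same (round_vars \<union> {''p'', ''q''}) s s1" "s1 ''F'' = s ''F''"
    using sameD[of "{''i'', ''j'', ''H''}" s s1 "''F''"]
    by (auto intro: same_trans[OF _ same_refl] simp: round_vars_def)
  then have inv1: "greedy_inv n k E s [] s1"
    using s1 F by (simp add: greedy_inv_def tab_def marks_def routes_def)
  have k: "s' ''k'' 0 = k" if "greedy_inv n k E s ps s'" for s' ps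
  proof -
    have "same (round_vars \<union> {''p'', ''q''}) s s'" using that by (simp add: greedy_inv_def)
    from sameD[OF this, of "''k''"] show ?thesis using sizedD(2)[OF sz]
      by (simp add: round_vars_def route_vars_def)
  qed
  let ?I = "\<lambda>t s'. \<exists>ps. length ps = t \<and> greedy_inv n k E s ps s'"
  show "runs (For ''p'' ''k'' (For ''q'' ''k'' greedy_round)) s1 (for_time k (for_time k (round_time n k))) (?I (k * k))"
  proof (rule runs_For[where I = "\<lambda>t. ?I (t * k)"])
    fix t s' assume t: "t < k" "?I (t * k) s'" "s' ''p'' 0 = t"
    have "runs (For ''q'' ''k'' greedy_round) s' (for_time k (round_time n k))
       (\<lambda>s'. s' ''p'' 0 = t \<and> ?I (t * k + k) s')"
    proof (rule runs_For[where I = "\<lambda>u s'. s' ''p'' 0 = t \<and> ?I (t * k + u) s'"])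
      fix u s2 assume u: "u < k" "s2 ''p'' 0 = t \<and> ?I (t * k + u) s2" "s2 ''q'' 0 = u"
      then obtain ps where ps: "length ps = t * k + u" "greedy_inv n k E s ps s2" by blast
      show "runs greedy_round s2 (round_time n k) (\<lambda>s'. s' ''q'' 0 = u \<and>
         (s'(''q'' := (s' ''q'')(0 := Suc u))) ''p'' 0 = t \<and> ?I (t * k + Suc u) (s'(''q'' := (s' ''q'')(0 := Suc u))))"
      proof (rule runs_weaken[OF runs_greedy_round[OF sz n o P Q E ps(2)] order.refl], assumption+, elim conjE exE)
        fix s3 p assume same: "same round_vars s2 s3" and p: "greedy_inv n k E s (p # ps) s3"
        have "s3 ''p'' = s2 ''p''" "s3 ''q'' = s2 ''q''"
          using sameD[OF same] by (simp_all add: round_vars_def route_vars_def)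
        then show "s3 ''q'' 0 = u \<and>
         (s3(''q'' := (s3 ''q'')(0 := Suc u))) ''p'' 0 = t \<and> ?I (t * k + Suc u) (s3(''q'' := (s3 ''q'')(0 := Suc u)))"
          using u p ps(1) by (auto simp: greedy_inv_upd intro!: exI[of _ "p # ps"])
      qed
    next
      fix u s2 assume "s2 ''p'' 0 = t \<and> ?I (t * k + u) s2"
      then show "s2 ''k'' 0 = k" using k by blast
    qed (use t in \<open>auto simp: greedy_inv_upd\<close>)
    then show "runs (For ''q'' ''k'' greedy_round) s' (for_time k (round_time n k))
       (\<lambda>s'. s' ''p'' 0 = t \<and> ?I (Suc t * k) (s'(''p'' := (s' ''p'')(0 := Suc t))))"
      by (rule runs_weaken) (auto simp: greedy_inv_upd add.commute)
  next
    fix t s' assume "?I (t * k) s'"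
    then show "s' ''k'' 0 = k" using k by blast
  qed (use inv1 in \<open>auto simp: greedy_inv_upd\<close>)
qed

definition "comp_all = For2 (If (Eq (var ''i'') (var ''j'')) Skip
  (If (Less (N 0) (Read ''E'' (idx ''i'' ''j''))) Skip (Write ''F'' (idx ''i'' ''j'') (N 1))))"

lemma runs_comp_all:
  assumes sz: "sized n k s"
    and E: "\<forall>x < n. \<forall>y < n. s ''E'' (x * n + y) = of_bool ({x, y} \<in> E)"
    and F: "\<And>q. s ''F'' q = 0"
  shows "runs comp_all s (for2_time n 50) (\<lambda>s'. marks n E (s' ''F'') UNIV)"
proof -
  have "runs comp_all s (for2_time n 50) (\<lambda>s'. same {''i'', ''j'', ''F''} s s' \<and>
    (\<forall>x < n. \<forall>y < n. s' ''F'' (x * n + y) = of_bool ({x, y} \<in> UNIV \<inter> non_edges {0..<n} E)))"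
    unfolding comp_all_def
  proof (rule runs_fill[OF sz])
    fix i j s' assume ij: "i < n" "j < n" and I: "same {''i'', ''j'', ''F''} s s'"
      and *: "s' ''i'' 0 = i" "s' ''j'' 0 = j"
      and F': "\<And>x y. x < n \<Longrightarrow> y < n \<Longrightarrow> s' ''F'' (x * n + y) =
        (if x * n + y < i * n + j then of_bool ({x, y} \<in> UNIV \<inter> non_edges {0..<n} E) else s ''F'' (x * n + y))"
    have "s' ''F'' (i * n + j) = 0" using F'[OF ij] F by simp
    moreover have "s' ''E'' (i * n + j) = of_bool ({i, j} \<in> E)" "s' ''R'' i = i * n"
      using sameD[OF I, of "''R''"] sameD[OF I, of "''E''"] sizedD(4)[OF sz, of i] ij E by simp_all
    ultimately show "result (If (Eq (var ''i'') (var ''j'')) Skip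
      (If (Less (N 0) (Read ''E'' (idx ''i'' ''j''))) Skip (Write ''F'' (idx ''i'' ''j'') (N 1)))) s' =
      s'(''F'' := (s' ''F'')(i * n + j := of_bool ({i, j} \<in> UNIV \<inter> non_edges {0..<n} E)))"
      using ij * by (auto simp: non_edges_def pairs_def fun_upd_idem)
  qed auto
  then show ?thesis by (rule runs_weaken) (auto simp: marks_def)
qed

section \<open>The whole program\<close>

text \<open>Grouping the cells by rows identifies the sum formed by the program with the one in the
  definition of the infinite value \<open>b\<close>.\<close>

lemma sum_matrix: "(\<Sum>q<n * n. matrix n w q) = (\<Sum>x<n. \<Sum>y<n. weight0 w x y)"
proof -
  have "(\<Sum>q<n * n. matrix n w q) = (\<Sum>x<n. sum (matrix n w) {x * n..<x * n + n})"
    by (rule sum.nat_group[symmetric])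
  also have "\<dots> = (\<Sum>x<n. \<Sum>y<n. weight0 w x y)"
  proof (rule sum.cong[OF refl])
    fix x assume "x \<in> {..<n}"
    have "sum (matrix n w) {x * n..<x * n + n} = (\<Sum>y<n. matrix n w (y + x * n))"
      using sum.shift_bounds_nat_ivl[of "matrix n w" 0 "x * n" n]
      by (simp add: add.commute atLeast0LessThan)
    also have "\<dots> = (\<Sum>y<n. weight0 w x y)"
      using \<open>x \<in> {..<n}\<close> index_less[of x n]
      by (intro sum.cong) (auto simp: matrix_def weight0_def add.commute)
    finally show "sum (matrix n w) {x * n..<x * n + n} = (\<Sum>y<n. weight0 w x y)" .
  qed
  finally show ?thesis .
qed

lemma matrix_index:
  "x < n \<Longrightarrow> y < n \<Longrightarrow> matrix n f (x * n + y) = (if x = y then 0 else f {x, y})"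
  using index_less[of x n y] by (auto simp: matrix_def)

definition "main_case = Seq comp_infinity (Seq comp_init (Seq comp_floyd (Seq comp_layers comp_greedy)))"

definition "main_time n k = 3 + for2_time n 30 + (for2_time n 50 + (for_time n (for2_time n 50) +
  (6 + (for2_time n (80 + for_time n 80) + for_time k (20 + for2_time n (80 + for_time n 80))) +
   (for2_time n 30 + for_time k (for_time k (round_time n k))))))"

lemma runs_main_case:
  assumes sz: "sized n k s" and n: "0 < n" and E: "E \<subseteq> pairs {0..<n}"
    and sE: "s ''E'' = matrix n (\<lambda>e. of_bool (e \<in> E))" and sw: "s ''w'' = matrix n w"
    and sF: "\<And>q. s ''F'' q = 0"
  shows "runs main_case s (main_time n k) (\<lambda>s'. \<exists>S. marks n E (s' ''F'') S \<and>
    approx_solution ((k + 1)\<^sup>2) 3 {0..<n} E w (\<lambda>_. 1) k (S \<inter> non_edges {0..<n} E))"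
proof -
  let ?b = "1 + 3 * (\<Sum>x<n. \<Sum>y<n. weight0 w x y)"
  let ?d = "\<lambda>x y. if x = y then 0 else if {x, y} \<in> E then weight0 w x y else ?b"
  have E_mat: "matrix n (\<lambda>e. of_bool (e \<in> E)) (x * n + y) = of_bool ({x, y} \<in> E)" if "x < n" "y < n" for x y
    using that E by (auto simp: matrix_index pairs_def)
  have w_mat: "matrix n w (x * n + y) = weight0 w x y" if "x < n" "y < n" for x y
    using that by (simp add: matrix_index weight0_def)
  have b: "weight0 w x y \<le> ?b" if "x < n" "y < n" for x y
  proof -
    have "weight0 w x y \<le> (\<Sum>y<n. weight0 w x y)" using that by (intro member_le_sum) auto
    also have "\<dots> \<le> (\<Sum>x<n. \<Sum>y<n. weight0 w x y)"
      using that by (intro member_le_sum[of x "{..<n}" "\<lambda>x. \<Sum>y<n. weight0 w x y"]) auto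
    finally show ?thesis by simp
  qed
  show ?thesis
    unfolding main_case_def main_time_def
  proof (rule runs_Seq[OF runs_comp_infinity[OF sz]], elim conjE)
    fix s1 assume same1: "same {''i'', ''j'', ''b''} s s1"
      and b1: "s1 ''b'' 0 = 1 + 3 * (\<Sum>q<n * n. s ''w'' q)"
    have sz1: "sized n k s1" using sized_same[OF same1] sz by simp
    have eq1: "s1 ''E'' = s ''E''" "s1 ''w'' = s ''w''" "s1 ''F'' = s ''F''"
      using sameD[OF same1] by simp_all
    have b1': "s1 ''b'' 0 = ?b" using b1 sum_matrix[of n w] by (simp add: sw)
    show "runs (Seq comp_init (Seq comp_floyd (Seq comp_layers comp_greedy))) s1 (for2_time n 50 +
      (for_time n (for2_time n 50) + (6 + (for2_time n (80 + for_time n 80) +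
        for_time k (20 + for2_time n (80 + for_time n 80))) +
       (for2_time n 30 + for_time k (for_time k (round_time n k))))))
      (\<lambda>s'. \<exists>S. marks n E (s' ''F'') S \<and>
        approx_solution ((k + 1)\<^sup>2) 3 {0..<n} E w (\<lambda>_. 1) k (S \<inter> non_edges {0..<n} E))"
    proof (rule runs_Seq[OF runs_comp_init[OF sz1]], elim conjE)
      fix s2 assume same2: "same {''i'', ''j'', ''D''} s1 s2"
        and D2: "\<forall>x < n. \<forall>y < n. s2 ''D'' (x * n + y) = (if x = y then 0
          else if 0 < s1 ''E'' (x * n + y) then s1 ''w'' (x * n + y) else s1 ''b'' 0)"
      have sz2: "sized n k s2" using sized_same[OF same2] sz1 by simp
      have eq2: "s2 ''E'' = s ''E''" "s2 ''w'' = s ''w''" "s2 ''F'' = s ''F''"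
        using sameD[OF same2] eq1 by simp_all
      have d2: "s2 ''D'' (x * n + y) = ?d x y" if "x < n" "y < n" for x y
        unfolding D2[rule_format, OF that] eq1 sE sw E_mat[OF that] w_mat[OF that] b1' by simp
      show "runs (Seq comp_floyd (Seq comp_layers comp_greedy)) s2
        (for_time n (for2_time n 50) + (6 + (for2_time n (80 + for_time n 80) +
          for_time k (20 + for2_time n (80 + for_time n 80))) +
         (for2_time n 30 + for_time k (for_time k (round_time n k)))))
        (\<lambda>s'. \<exists>S. marks n E (s' ''F'') S \<and>
          approx_solution ((k + 1)\<^sup>2) 3 {0..<n} E w (\<lambda>_. 1) k (S \<inter> non_edges {0..<n} E))"
      proof (rule runs_Seq[OF runs_comp_floyd[OF sz2]], elim conjE)
        fix s3 assume same3: "same {''m'', ''i'', ''j'', ''D''} s2 s3"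
          and D3: "\<forall>x < n. \<forall>y < n. s3 ''D'' (x * n + y) = floyd (\<lambda>x y. s2 ''D'' (x * n + y)) n x y"
        have sz3: "sized n k s3" using sized_same[OF same3] sz2 by simp
        have eq3: "s3 ''E'' = s ''E''" "s3 ''w'' = s ''w''" "s3 ''F'' = s ''F''"
          using sameD[OF same3] eq2 by simp_all
        have apsp: "apsp n E w ?b (floyd (\<lambda>x y. s2 ''D'' (x * n + y)) n)"
          using E b d2 by (rule apsp_floyd)
        show "runs (Seq comp_layers comp_greedy) s3 (6 + (for2_time n (80 + for_time n 80) +
            for_time k (20 + for2_time n (80 + for_time n 80))) +
           (for2_time n 30 + for_time k (for_time k (round_time n k))))
          (\<lambda>s'. \<exists>S. marks n E (s' ''F'') S \<and>
            approx_solution ((k + 1)\<^sup>2) 3 {0..<n} E w (\<lambda>_. 1) k (S \<inter> non_edges {0..<n} E))"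
        proof (rule runs_Seq[OF runs_comp_layers[OF sz3]], elim conjE)
          fix s4 assume same4: "same layer_vars s3 s4" and o4: "s4 ''o'' 0 = k * (n * n)"
            and D4: "\<forall>q < n * n. s4 ''D'' q = s3 ''D'' q"
            and c4: "min_plus n (tab n (s4 ''D'') 0) (tab n (s3 ''w'') 0) (tab n (s4 ''c'') 0) (tab n (s4 ''Q'') 0)"
            and P4: "\<forall>l < k. min_plus n (tab n (s4 ''c'') 0) (tab n (s4 ''D'') (l * (n * n)))
              (tab n (s4 ''D'') (Suc l * (n * n))) (tab n (s4 ''P'') (l * (n * n)))"
          have sz4: "sized n k s4" using sized_same[OF same4] sz3 by (simp add: layer_vars_def)
          have eq4: "s4 ''E'' = s ''E''" "s4 ''F'' = s ''F''"
            using sameD[OF same4] eq3 by (simp_all add: layer_vars_def)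
          let ?D = "\<lambda>l. tab n (s4 ''D'') (l * (n * n))" and ?P = "\<lambda>l. tab n (s4 ''P'') (l * (n * n))"
          have apsp4: "apsp n E w ?b (?D 0)"
            using apsp D3 D4 index_less by (simp add: apsp_def tab_def)
          have c4': "min_plus n (?D 0) (weight0 w) (tab n (s4 ''c'') 0) (tab n (s4 ''Q'') 0)"
            by (rule min_plus_cong[OF c4]) (simp_all add: eq3 sw tab_def w_mat)
          \<comment> \<open>The memory now satisfies the abstract assumptions on the tables, so the
            analysis of the greedy choice applies to whichever pairs the program selects.\<close>
          interpret distance_tables n k E w ?b ?D ?P "tab n (s4 ''c'') 0" "tab n (s4 ''Q'') 0"
            using E apsp4 c4' P4 by unfold_locales simp_all
          have "runs comp_greedy s4 (for2_time n 30 + for_time k (for_time k (round_time n k)))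
            (\<lambda>s'. \<exists>ps. length ps = k * k \<and> greedy_inv n k E s4 ps s')"
          proof (rule runs_comp_greedy[OF sz4 n o4])
            show "\<forall>x < n. \<forall>y < n. s4 ''E'' (x * n + y) = of_bool ({x, y} \<in> E)"
              using E_mat by (simp add: eq4 sE)
          qed (use min_plusD(1)[OF c4] min_plusD(1)[OF P4[rule_format]] sF eq4 in auto)
          then show "runs comp_greedy s4 (for2_time n 30 + for_time k (for_time k (round_time n k)))
            (\<lambda>s'. \<exists>S. marks n E (s' ''F'') S \<and>
              approx_solution ((k + 1)\<^sup>2) 3 {0..<n} E w (\<lambda>_. 1) k (S \<inter> non_edges {0..<n} E))"
          proof (rule runs_weaken[OF _ order.refl], elim exE conjE)
            fix s' ps assume ps: "length ps = k * k" "greedy_inv n k E s4 ps s'"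
            then have "greedy n (?D 0) (?D k) ps" by (simp add: greedy_inv_def)
            from approx_solution_greedy[OF this ps(1)] ps(2)
            show "\<exists>S. marks n E (s' ''F'') S \<and>
              approx_solution ((k + 1)\<^sup>2) 3 {0..<n} E w (\<lambda>_. 1) k (S \<inter> non_edges {0..<n} E)"
              by (auto simp: greedy_inv_def)
          qed
        qed
      qed
    qed
  qed
qed

section \<open>Summation of the running times\<close>

lemma for_time_le:
  assumes "1 \<le> m" "1 \<le> X" "T \<le> c * X"
  shows "for_time m T \<le> (c + 21) * (m * X)"
proof -
  have "m * T \<le> m * (c * X)" using assms(3) by (rule mult_le_mono2)
  also have "m * (c * X) = c * (m * X)" by (rule mult.left_commute)
  finally have "m * T \<le> c * (m * X)" .
  moreover have "m \<le> m * X" "1 \<le> m * X" using assms(1,2) by simp_all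
  ultimately show ?thesis unfolding for_time_def distrib_left distrib_right by linarith
qed

text \<open>Each loop adds 21 to the constant: 12 for the overhead of an iteration and 9 for the
  overhead of the loop. Two nested loops add 42.\<close>

lemma for2_time_le:
  assumes "1 \<le> n" "1 \<le> X" "T \<le> c * X"
  shows "for2_time n T \<le> (c + 42) * (n * (n * X))"
  using for_time_le[OF assms(1) _ for_time_le[OF assms]] assms
  unfolding for2_time_def by (simp add: add.commute)

lemma main_time_le:
  assumes k: "1 \<le> k" "k \<le> n"
  shows "main_time n k \<le> 1400 * (k * n ^ 3)"
proof -
  have n: "1 \<le> n" using k by simp
  define Z where "Z = n * n"
  define A where "A = n * Z"
  define G where "G = k * (k * Z)"
  define K where "K = k * A"
  have K: "k * n ^ 3 = K" by (simp add: K_def A_def Z_def power3_eq_cube)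
  have Z: "1 \<le> Z" using n by (simp add: Z_def)
  have A: "Z \<le> A" using n by (simp add: A_def)
  have KA: "A \<le> K" using k by (simp add: K_def)
  \<comment> \<open>Here \<open>k \<le> n\<close> turns \<open>k * k\<close> rounds of quadratic
    cost into \<open>O(k n^3)\<close>.\<close>
  have G: "G \<le> K" using k by (simp add: G_def K_def A_def)
  have "k * 1 \<le> n * n" using k n by (intro mult_le_mono)
  then have kZ: "k \<le> Z" by (simp add: Z_def)
  have f2: "for2_time n c \<le> (c + 42) * Z" for c using for2_time_le[OF n, of 1 c c] by (simp add: Z_def)
  have f: "for2_time n 30 \<le> 72 * Z" "for2_time n 50 \<le> 92 * Z" "for2_time n 60 \<le> 102 * Z"
      "for2_time n 120 \<le> 162 * Z"
    using f2[of 30] f2[of 50] f2[of 60] f2[of 120] by simp_all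
  have fl: "for_time n (for2_time n 50) \<le> 113 * A"
    using for_time_le[OF n Z f(2)] by (simp add: A_def)
  have "for_time n 80 \<le> 101 * n" using for_time_le[OF n, of 1 80 80] by simp
  then have "80 + for_time n 80 \<le> 181 * n" using n by linarith
  from for2_time_le[OF n n this] have p: "for2_time n (80 + for_time n 80) \<le> 223 * A"
    by (simp add: A_def Z_def)
  then have "20 + for2_time n (80 + for_time n 80) \<le> 243 * A" using A Z by linarith
  from for_time_le[OF k(1) _ this] A Z
  have l: "for_time k (20 + for2_time n (80 + for_time n 80)) \<le> 264 * K" by (simp add: K_def)
  have "for_time k 120 \<le> 141 * k" using for_time_le[OF k(1), of 1 120 120] by simp
  then have "round_time n k \<le> 445 * Z" unfolding round_time_def using f kZ Z by linarith
  from for_time_le[OF k(1) _ for_time_le[OF k(1) Z this]] k Z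
  have g: "for_time k (for_time k (round_time n k)) \<le> 487 * G" by (simp add: G_def)
  show ?thesis unfolding main_time_def K using f fl p l g Z A KA G by linarith
qed

text \<open>For \<open>k = 0\<close> the time bound is a constant, so the program must stop before
  any loop; the untouched zero array \<open>F\<close> already encodes the empty set. For
  \<open>k \<ge> n\<close> all non-edges are output, as the greedy rounds would take too
  long.\<close>

definition "algorithm = If (Less (var ''k'') (N 1)) Skip
  (Seq comp_rows (If (Less (var ''k'') (var ''n'')) main_case comp_all))"

lemma outputs_marks:
  assumes "marks n E (s ''F'') S"
  shows "outputs s n (S \<inter> non_edges {0..<n} E)"
  unfolding outputs_def
proof (intro allI impI)
  fix m assume m: "m < n * n"
  then have n: "0 < n" by (cases n) auto
  have xy: "m div n < n" "m mod n < n" using m n by (simp_all add: less_mult_imp_div_less)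
  have "s ''F'' m = of_bool ({m div n, m mod n} \<in> S \<inter> non_edges {0..<n} E)"
    using assms xy unfolding marks_def by (metis div_mult_mod_eq)
  then show "s ''F'' m = matrix n (\<lambda>e. of_bool (e \<in> S \<inter> non_edges {0..<n} E)) m"
    using m by (auto simp: matrix_def non_edges_def pairs_def)
qed

lemma runs_algorithm:
  assumes E: "E \<subseteq> pairs {0..<n}"
  shows "runs algorithm (input_state n k E w) (2000 * max 1 (k * n ^ 3)) (\<lambda>s. \<exists>F. outputs s n F \<and>
    approx_solution ((k + 1)\<^sup>2) 3 {0..<n} E w (\<lambda>_. 1) k F)"
proof -
  let ?s = "input_state n k E w"
  let ?Q = "\<lambda>s. \<exists>F. outputs s n F \<and> approx_solution ((k + 1)\<^sup>2) 3 {0..<n} E w (\<lambda>_. 1) k F"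
  \<comment> \<open>The outer test takes 5 steps.\<close>
  let ?T = "2000 * max 1 (k * n ^ 3) - 5"
  have "runs algorithm ?s (bcost (Less (var ''k'') (N 1)) + 1 + ?T) ?Q"
    unfolding algorithm_def
  proof (rule runs_If)
    assume "bval (Less (var ''k'') (N 1)) ?s"
    then have "k = 0" by (simp add: input_state_def)
    moreover have "outputs ?s n {}" by (simp add: outputs_def input_state_def matrix_def)
    ultimately have "?Q ?s" using approx_solution_empty[of "{0..<n}" "(k + 1)\<^sup>2" E w]
      by (intro exI[of _ "{}"]) simp
    then have "runs Skip ?s 1 ?Q" by (rule runs_Skip[where Q = ?Q])
    then show "runs Skip ?s ?T ?Q" by (rule runs_weaken) auto
  next
    assume "\<not> bval (Less (var ''k'') (N 1)) ?s"
    then have k: "1 \<le> k" by (simp add: input_state_def)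
    have "?s ''n'' 0 = n" "?s ''k'' 0 = k" "?s ''R'' 0 = 0" by (simp_all add: input_state_def)
    note R = runs_comp_rows[of ?s n k, OF this]
    let ?T' = "bcost (Less (var ''k'') (var ''n'')) + 1 + (if k < n then main_time n k else for2_time n 50)"
    have "runs (Seq comp_rows (If (Less (var ''k'') (var ''n'')) main_case comp_all)) ?s (for_time n 11 + 5 + ?T') ?Q"
    proof (rule runs_Seq[OF R], elim conjE)
      fix s1 assume same: "same {''m'', ''R'', ''nn''} ?s s1" and sz: "sized n k s1"
      have eq: "s1 ''E'' = matrix n (\<lambda>e. of_bool (e \<in> E))" "s1 ''w'' = matrix n w" "s1 ''F'' q = 0" for q
        using sameD[OF same] by (simp_all add: input_state_def)
      show "runs (If (Less (var ''k'') (var ''n'')) main_case comp_all) s1 ?T' ?Q"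
      proof (rule runs_If)
        assume "bval (Less (var ''k'') (var ''n'')) s1"
        then have kn: "k < n" using sizedD[OF sz] by simp
        then have "0 < n" by simp
        from runs_main_case[OF sz this E eq]
        show "runs main_case s1 (if k < n then main_time n k else for2_time n 50) ?Q"
        proof (rule runs_weaken, goal_cases)
          case (2 s')
          then show ?case using outputs_marks by blast
        qed (use kn in simp)
      next
        assume "\<not> bval (Less (var ''k'') (var ''n'')) s1"
        then have kn: "\<not> k < n" using sizedD[OF sz] by simp
        have "\<forall>x < n. \<forall>y < n. s1 ''E'' (x * n + y) = of_bool ({x, y} \<in> E)"
          unfolding eq using E by (auto simp: matrix_index pairs_def)
        from runs_comp_all[OF sz this eq(3)]
        show "runs comp_all s1 (if k < n then main_time n k else for2_time n 50) ?Q"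
        proof (rule runs_weaken)
          fix s2 assume "marks n E (s2 ''F'') UNIV"
          from outputs_marks[of n E s2 UNIV, OF this] have "outputs s2 n (non_edges {0..<n} E)" by simp
          moreover have "n \<le> k" using kn by simp
          ultimately show "?Q s2" using approx_solution_all by blast
        qed (use kn in simp)
      qed
    qed
    moreover have "for_time n 11 + 5 + ?T' \<le> ?T"
    proof (cases "n = 0")
      case True
      \<comment> \<open>Without vertices \<open>k * n ^ 3\<close> vanishes as well; the loops end at
        once and \<open>max 1\<close> supplies the constant bound.\<close>
      then show ?thesis by (simp add: for2_time_def for_time_def)
    next
      case False
      then have n: "1 \<le> n" by simp
      define K where "K = k * n ^ 3"
      have "n * n * 1 \<le> n * n * (k * n)" using k n by (intro mult_le_mono2) simp
      then have sq: "n * n \<le> K" by (simp add: K_def power3_eq_cube ac_simps)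
      have "n \<le> n * n" by simp
      then have le: "n \<le> K" using sq by (rule order_trans)
      have "for2_time n 50 \<le> 92 * (n * n)" using for2_time_le[OF n, of 1 50 50] by simp
      also have "\<dots> \<le> 92 * K" using sq by (rule mult_le_mono2)
      finally have f2: "for2_time n 50 \<le> 92 * K" .
      have f: "for_time n 11 \<le> 32 * n" using for_time_le[OF n, of 1 11 11] by simp
      have m: "main_time n k \<le> 1400 * K" if "k < n" using main_time_le[OF k] that by (simp add: K_def)
      have "max 1 K = K" using le n by simp
      moreover have "(if k < n then main_time n k else for2_time n 50) \<le> 1400 * K"
        using f2 m by simp
      ultimately show ?thesis using f le n unfolding K_def[symmetric] by (simp only: bcost.simps acost.simps)
    qed
    ultimately show "runs (Seq comp_rows (If (Less (var ''k'') (var ''n'')) main_case comp_all)) ?s ?T ?Q"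
      by (rule runs_weaken)
  qed
  then show ?thesis by (rule runs_weaken) auto
qed

theorem theorem3:
  shows "\<exists>(p :: com) (C :: nat).
    \<forall>(n :: nat) (k :: nat) (E :: nat set set) (w :: nat set \<Rightarrow> nat).
      E \<subseteq> pairs {0..<n} \<longrightarrow>
      (\<exists>t s F. exec p (input_state n k E w) t s \<and>
               t \<le> C * max 1 (k * n ^ 3) \<and>
               outputs s n F \<and>
               approx_solution ((k + 1)\<^sup>2) 3 {0..<n} E w (\<lambda>_. 1) k F)"
proof (rule exI[of _ algorithm], rule exI[of _ 2000], intro allI impI)
  fix n k :: nat and E :: "nat set set" and w :: "nat set \<Rightarrow> nat"
  assume "E \<subseteq> pairs {0..<n}"
  from runs_algorithm[OF this, of k w]
  show "\<exists>t s F. exec algorithm (input_state n k E w) t s \<and> t \<le> 2000 * max 1 (k * n ^ 3) \<and>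
      outputs s n F \<and> approx_solution ((k + 1)\<^sup>2) 3 {0..<n} E w (\<lambda>_. 1) k F"
    unfolding runs_def by metis
qed

end
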